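(* Let $(\mathcal{H},T,L,\{w_i\}_{i\in I})$ be a tuple with $L$ invertible, i.e. $\mathcal{H}$ is a separable complex Hilbert space, $T,L\in\mathcal{B}(\mathcal{H})$ are invertible, $TL=LT$, and $\{w_i\}_{i\in I}\subset\mathcal{H}$ is an at most countable family. Then $(\mathcal{H},T,L,\{w_i\}_{i\in I})$ is a bilateral frame-tuple if and only if it is similar to a bilateral basic tuple (with index set $I$). Moreover, this basic tuple is unique.
   Context: All Hilbert spaces are complex and separable; $\mathcal{B}(\mathcal{H})$ denotes the bounded linear operators on $\mathcal{H}$, $\mathbb{T}$ is the unit circle with normalized Lebesgue measure ($\mathbb{T}^2$ likewise), and $P_{\mathcal N}$ is the orthogonal projection onto a closed subspace $\mathcal N$. A tuple $(\mathcal{H},T,L,\{w_i\}_{i\in I})$ with $T,L$ commuting invertible operators in $\mathcal{B}(\mathcal{H})$ and $I$ at most countable is a bilateral frame-tuple if $\{T^kL^jw_i: k,j\in\mathbb{Z}, i\in I\}$ is a frame of $\mathcal{H}$. Similarity. $(\mathcal{H}_1,T_1,L_1,\{v_i\}_{i\in I})$ and $(\mathcal{H}_2,T_2,L_2,\{w_i\}_{i\in I})$ (same index set) are similar if there is a bounded isomorphism (bounded linear bijection) $C:\mathcal{H}_1\to\mathcal{H}_2$ with $Cv_i=w_i$ for all $i\in I$, $T_2C=CT_1$ and $L_2C=CL_1$. On $L^2(\mathbb{T}^2,\ell^2(I))$ (square-integrable measurable $\ell^2(I)$-valued functions) define $(U_mf)(z_1,z_2)=z_mf(z_1,z_2)$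 for $m=1,2$. A vector of $\ell^2(I)$ is identified with the corresponding constant function. A closed subspace is reducing for an operator $A$ if it is invariant under $A$ and $A^*$. Bilateral basic tuple. A tuple $(\mathcal N,U_1|_{\mathcal N},U_2|_{\mathcal N},\{\varphi_i\}_{i\in I})$ where $\mathcal N$ is a closed subspace of $L^2(\mathbb{T}^2,\ell^2(I))$ reducing for $U_1$ and $U_2$, and $\varphi_i=P_{\mathcal N}\varepsilon_i$, with $\{\varepsilon_i\}_{i\in I}$ the canonical orthonormal basis of $\ell^2(I)$. *)

theory Defs
  imports "HOL-Analysis.Analysis" "HOL-Probability.Probability"
begin

section \<open>Complex Hilbert spaces\<close>

text \<open>
  The real inner product of the library class is required to be the real part of the complex one,
  so that norm, topology and completeness are those of the library. The complex inner product is
  linear in its first argument.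
\<close>

class complex_inner = real_inner +
  fixes scaleC :: "complex \<Rightarrow> 'a \<Rightarrow> 'a" (infixr "*\<^sub>C" 75)
    and cinner :: "'a \<Rightarrow> 'a \<Rightarrow> complex"
  assumes scaleC_add_right: "c *\<^sub>C (x + y) = c *\<^sub>C x + c *\<^sub>C y"
    and scaleC_add_left: "(c + d) *\<^sub>C x = c *\<^sub>C x + d *\<^sub>C x"
    and scaleC_scaleC: "c *\<^sub>C d *\<^sub>C x = (c * d) *\<^sub>C x"
    and scaleC_of_real: "complex_of_real r *\<^sub>C x = r *\<^sub>R x"
    and cinner_commute: "cinner x y = cnj (cinner y x)"
    and cinner_add_left: "cinner (x + y) z = cinner x z + cinner y z"
    and cinner_scaleC_left: "cinner (c *\<^sub>C x) y = c * cinner x y"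
    and inner_eq_Re_cinner: "inner x y = Re (cinner x y)"

class chilbert_space = complex_inner + complete_space

lemma scaleC_one [simp]: "1 *\<^sub>C x = (x :: 'a :: complex_inner)"
  using scaleC_of_real[of 1 x] by simp

lemma scaleC_minus1: "(- 1) *\<^sub>C x = - (x :: 'a :: complex_inner)"
  using scaleC_of_real[of "-1" x] by simp

lemma cinner_minus_left: "cinner (- x) y = - cinner x (y :: 'a :: complex_inner)"
  by (metis scaleC_minus1 cinner_scaleC_left mult_minus1)

lemma cinner_diff_left: "cinner (x - z) y = cinner x y - cinner z (y :: 'a :: complex_inner)"
  by (metis cinner_add_left cinner_minus_left diff_conv_add_uminus)

lemma cinner_add_right: "cinner x (y + z) = cinner x y + cinner x (z :: 'a :: complex_inner)"
  by (metis cinner_add_left cinner_commute complex_cnj_add)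

lemma cinner_scaleC_right: "cinner x (c *\<^sub>C y) = cnj c * cinner x (y :: 'a :: complex_inner)"
  by (metis cinner_scaleC_left cinner_commute complex_cnj_mult)

lemma cinner_self: "cinner x x = complex_of_real ((norm (x :: 'a :: complex_inner))\<^sup>2)"
proof -
  have "Im (cinner x x) = 0"
    using arg_cong[OF cinner_commute[of x x], of Im] by simp
  then show ?thesis
    by (simp add: complex_eq_iff power2_norm_eq_inner inner_eq_Re_cinner)
qed

lemma norm_scaleC: "norm (c *\<^sub>C (x :: 'a :: complex_inner)) = cmod c * norm x"
proof -
  have "complex_of_real ((norm (c *\<^sub>C x))\<^sup>2) = c * cnj c * complex_of_real ((norm x)\<^sup>2)"
    by (simp only: cinner_self[symmetric] cinner_scaleC_left cinner_scaleC_right mult.assoc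
        mult.left_commute)
  also have "\<dots> = complex_of_real ((cmod c * norm x)\<^sup>2)"
    by (simp add: power_mult_distrib complex_norm_square[symmetric])
  finally have "(norm (c *\<^sub>C x))\<^sup>2 = (cmod c * norm x)\<^sup>2"
    by (simp only: of_real_eq_iff)
  then show ?thesis
    by (simp add: power2_eq_iff_nonneg)
qed

lemma bounded_linear_scaleC: "bounded_linear (\<lambda>x :: 'a :: complex_inner. c *\<^sub>C x)"
  by (rule bounded_linear_intro[where K = "cmod c"])
    (simp_all add: scaleC_add_right norm_scaleC scaleC_scaleC flip: scaleC_of_real, 
     simp add: mult.commute)

lemma cinner_eq_inner: "cinner x y = Complex (inner x y) (inner x (\<i> *\<^sub>C (y :: 'a :: complex_inner)))"
  by (simp add: inner_eq_Re_cinner complex_eq_iff cinner_scaleC_right)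

lemma norm_cinner_le: "cmod (cinner x y) \<le> norm x * norm (y :: 'a :: complex_inner)"
proof (cases "cinner x y = 0")
  case False
  define c where "c = cnj (sgn (cinner x y))"
  have c: "cmod c = 1"
    using False by (simp add: c_def norm_sgn)
  have "complex_of_real (cmod (cinner x y)) = c * cinner x y"
    using False complex_norm_square[of "cinner x y"]
    by (simp add: c_def sgn_eq field_simps power2_eq_square)
  then have "cmod (cinner x y) = inner (c *\<^sub>C x) y"
    unfolding inner_eq_Re_cinner cinner_scaleC_left by (metis Re_complex_of_real)
  also have "\<dots> \<le> norm (c *\<^sub>C x) * norm y"
    by (rule norm_cauchy_schwarz)
  finally show ?thesis
    by (simp add: norm_scaleC c)
qed simp

section \<open>The space of square-summable families\<close>

typedef 'i ell2 = "{x :: 'i \<Rightarrow> complex. (\<lambda>i. (cmod (x i))\<^sup>2) summable_on UNIV}"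
  morphisms ell2_coeff Abs_ell2
  by (rule exI[of _ "\<lambda>_. 0"]) simp

setup_lifting type_definition_ell2

lemma sq_summable_add:
  fixes x y :: "'i \<Rightarrow> complex"
  assumes "(\<lambda>i. (cmod (x i))\<^sup>2) summable_on A" "(\<lambda>i. (cmod (y i))\<^sup>2) summable_on A"
  shows "(\<lambda>i. (cmod (x i + y i))\<^sup>2) summable_on A"
proof (rule summable_on_comparison_test)
  show "(\<lambda>i. 2 * (cmod (x i))\<^sup>2 + 2 * (cmod (y i))\<^sup>2) summable_on A"
    by (intro summable_on_add summable_on_cmult_right assms)
  show "(cmod (x i + y i))\<^sup>2 \<le> 2 * (cmod (x i))\<^sup>2 + 2 * (cmod (y i))\<^sup>2" for i
  proof -
    have "(cmod (x i + y i))\<^sup>2 \<le> (cmod (x i) + cmod (y i))\<^sup>2"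
      by (simp add: norm_triangle_ineq power_mono)
    also have "\<dots> \<le> 2 * (cmod (x i))\<^sup>2 + 2 * (cmod (y i))\<^sup>2"
      using zero_le_power2[of "cmod (x i) - cmod (y i)"] by (simp add: power2_eq_square algebra_simps)
    finally show ?thesis .
  qed
qed auto

lemma sq_summable_mult:
  fixes x y :: "'i \<Rightarrow> complex"
  assumes "(\<lambda>i. (cmod (x i))\<^sup>2) summable_on A" "(\<lambda>i. (cmod (y i))\<^sup>2) summable_on A"
  shows "(\<lambda>i. x i * cnj (y i)) summable_on A"
proof (rule abs_summable_summable, rule summable_on_comparison_test)
  show "(\<lambda>i. (cmod (x i))\<^sup>2 + (cmod (y i))\<^sup>2) summable_on A"
    by (intro summable_on_add assms)
  show "norm (x i * cnj (y i)) \<le> (cmod (x i))\<^sup>2 + (cmod (y i))\<^sup>2" for i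
    using sum_squares_bound[of "cmod (x i)" "cmod (y i)"]
      mult_nonneg_nonneg[OF norm_ge_zero norm_ge_zero, of "x i" "y i"]
    unfolding norm_mult complex_mod_cnj by linarith
qed auto

lemma sq_summable_infsum:
  fixes x :: "'i \<Rightarrow> complex"
  assumes "(\<lambda>i. (cmod (x i))\<^sup>2) summable_on A"
  shows "(\<Sum>\<^sub>\<infinity>i\<in>A. x i * cnj (x i)) = complex_of_real (\<Sum>\<^sub>\<infinity>i\<in>A. (cmod (x i))\<^sup>2)"
proof (rule infsumI)
  have "((\<lambda>i. complex_of_real ((cmod (x i))\<^sup>2))
      has_sum complex_of_real (\<Sum>\<^sub>\<infinity>i\<in>A. (cmod (x i))\<^sup>2)) A"
    by (rule has_sum_bounded_linear[OF bounded_linear_of_real has_sum_infsum[OF assms]])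
  then show "((\<lambda>i. x i * cnj (x i)) has_sum complex_of_real (\<Sum>\<^sub>\<infinity>i\<in>A. (cmod (x i))\<^sup>2)) A"
    unfolding complex_norm_square .
qed

lemma sq_summable_scale:
  fixes x :: "'i \<Rightarrow> complex"
  assumes "(\<lambda>i. (cmod (x i))\<^sup>2) summable_on A"
  shows "(\<lambda>i. (cmod (c * x i))\<^sup>2) summable_on A"
  using summable_on_cmult_right[OF assms, of "(cmod c)\<^sup>2"] by (simp add: norm_mult power_mult_distrib)

instantiation ell2 :: (type) real_vector
begin

lift_definition zero_ell2 :: "'a ell2" is "\<lambda>_. 0" by simp

lift_definition plus_ell2 :: "'a ell2 \<Rightarrow> 'a ell2 \<Rightarrow> 'a ell2" is "\<lambda>x y i. x i + y i"
  by (rule sq_summable_add)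

lift_definition uminus_ell2 :: "'a ell2 \<Rightarrow> 'a ell2" is "\<lambda>x i. - x i"
  by simp

lift_definition minus_ell2 :: "'a ell2 \<Rightarrow> 'a ell2 \<Rightarrow> 'a ell2" is "\<lambda>x y i. x i - y i"
  using sq_summable_add[of _ UNIV "\<lambda>i. - _ i"] by simp

lift_definition scaleR_ell2 :: "real \<Rightarrow> 'a ell2 \<Rightarrow> 'a ell2" is "\<lambda>r x i. complex_of_real r * x i"
  by (rule sq_summable_scale)

instance
proof
  fix x y z :: "'a ell2" and r s :: real
  show "x + y + z = x + (y + z)" "x + y = y + x" "0 + x = x" "- x + x = 0" "x - y = x + - y"
    by (transfer, simp add: fun_eq_iff)+
  show "r *\<^sub>R (x + y) = r *\<^sub>R x + r *\<^sub>R y" "(r + s) *\<^sub>R x = r *\<^sub>R x + s *\<^sub>R x"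
    "r *\<^sub>R s *\<^sub>R x = (r * s) *\<^sub>R x" "1 *\<^sub>R x = x"
    by (transfer, simp add: fun_eq_iff algebra_simps)+
qed

end

instantiation ell2 :: (type) complex_inner
begin

lift_definition scaleC_ell2 :: "complex \<Rightarrow> 'a ell2 \<Rightarrow> 'a ell2" is "\<lambda>c x i. c * x i"
  by (rule sq_summable_scale)

lift_definition cinner_ell2 :: "'a ell2 \<Rightarrow> 'a ell2 \<Rightarrow> complex"
  is "\<lambda>x y. \<Sum>\<^sub>\<infinity>i. x i * cnj (y i)" .

definition inner_ell2 :: "'a ell2 \<Rightarrow> 'a ell2 \<Rightarrow> real"
  where "inner_ell2 x y = Re (cinner x y)"

definition norm_ell2 :: "'a ell2 \<Rightarrow> real"
  where "norm_ell2 x = sqrt (inner x x)"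

definition dist_ell2 :: "'a ell2 \<Rightarrow> 'a ell2 \<Rightarrow> real"
  where "dist_ell2 x y = norm (x - y)"

definition sgn_ell2 :: "'a ell2 \<Rightarrow> 'a ell2"
  where "sgn_ell2 x = x /\<^sub>R norm x"

definition uniformity_ell2 :: "('a ell2 \<times> 'a ell2) filter"
  where "uniformity_ell2 = (INF e\<in>{0<..}. principal {(x, y). dist x y < e})"

definition open_ell2 :: "'a ell2 set \<Rightarrow> bool"
  where "open_ell2 U \<longleftrightarrow> (\<forall>x\<in>U. \<forall>\<^sub>F (x', y) in uniformity. x' = x \<longrightarrow> y \<in> U)"

instance
proof
  fix x y z :: "'a ell2" and c d :: complex and r s :: real and U :: "'a ell2 set"
  show "c *\<^sub>C (x + y) = c *\<^sub>C x + c *\<^sub>C y" "(c + d) *\<^sub>C x = c *\<^sub>C x + d *\<^sub>C x"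
    "c *\<^sub>C d *\<^sub>C x = (c * d) *\<^sub>C x" "complex_of_real r *\<^sub>C x = r *\<^sub>R x"
    by (transfer, simp add: fun_eq_iff algebra_simps)+
  show com: "cinner x y = cnj (cinner y x)" for x y :: "'a ell2"
    by transfer (simp add: infsum_cnj[symmetric] mult.commute)
  show add: "cinner (x + y) z = cinner x z + cinner y z"
    by transfer (simp add: distrib_right infsum_add sq_summable_mult)
  show scale: "cinner (c *\<^sub>C x) y = c * cinner x y" for c
    by transfer (simp add: mult.assoc infsum_cmult_right sq_summable_mult)
  show "inner x y = Re (cinner x y)" "norm x = sqrt (inner x x)" "dist x y = norm (x - y)"
    "sgn x = x /\<^sub>R norm x"
    "(uniformity :: ('a ell2 \<times> 'a ell2) filter) = (INF e\<in>{0<..}. principal {(x, y). dist x y < e})"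
    "open U \<longleftrightarrow> (\<forall>x\<in>U. \<forall>\<^sub>F (x', y) in uniformity. x' = x \<longrightarrow> y \<in> U)"
    by (rule inner_ell2_def norm_ell2_def dist_ell2_def sgn_ell2_def uniformity_ell2_def
        open_ell2_def)+
  show "inner x y = inner y x"
    unfolding inner_ell2_def using com[of x y] by simp
  show "inner (x + y) z = inner x z + inner y z"
    unfolding inner_ell2_def using add by simp
  have *: "r *\<^sub>R x = complex_of_real r *\<^sub>C x"
    by transfer simp
  show "inner (r *\<^sub>R x) y = r * inner x y"
    unfolding inner_ell2_def * using scale by simp
  have sq: "cinner x x = complex_of_real (\<Sum>\<^sub>\<infinity>i. (cmod (ell2_coeff x i))\<^sup>2)"
    by transfer (rule sq_summable_infsum)
  show "0 \<le> inner x x"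
    unfolding inner_ell2_def sq by (simp add: infsum_nonneg)
  show "(inner x x = 0) = (x = 0)"
  proof
    assume "inner x x = 0"
    then have "(\<Sum>\<^sub>\<infinity>i. (cmod (ell2_coeff x i))\<^sup>2) = 0"
      unfolding inner_ell2_def sq by simp
    then have "(cmod (ell2_coeff x i))\<^sup>2 = 0" for i
      using ell2_coeff[of x] by (intro nonneg_infsum_le_0D[where A = UNIV]) auto
    then show "x = 0"
      by transfer (simp add: fun_eq_iff)
  next
    assume "x = 0"
    then show "inner x x = 0"
      unfolding inner_ell2_def by simp (transfer, simp)
  qed
qed

end

lemma norm_ell2_sq: "(norm x)\<^sup>2 = (\<Sum>\<^sub>\<infinity>i. (cmod (ell2_coeff x i))\<^sup>2)"
proof -
  have "complex_of_real ((norm x)\<^sup>2) = complex_of_real (\<Sum>\<^sub>\<infinity>i. (cmod (ell2_coeff x i))\<^sup>2)"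
    unfolding cinner_self[symmetric]
    by transfer (rule sq_summable_infsum)
  then show ?thesis
    by (simp only: of_real_eq_iff)
qed


lemma norm_ell2_coeff_le: "cmod (ell2_coeff x i) \<le> norm x"
proof -
  have "(\<Sum>i\<in>{i}. (cmod (ell2_coeff x i))\<^sup>2) \<le> (norm x)\<^sup>2"
    unfolding norm_ell2_sq using ell2_coeff[of x] by (intro finite_sum_le_infsum) auto
  then show ?thesis
    by (simp add: power2_le_iff_abs_le)
qed

lemma ell2_coeff_diff: "ell2_coeff (x - y) i = ell2_coeff x i - ell2_coeff y i"
  by transfer simp

instance ell2 :: (type) chilbert_space
proof
  fix X :: "nat \<Rightarrow> 'a ell2"
  assume X: "Cauchy X"
  have "\<exists>l. (\<lambda>n. ell2_coeff (X n) i) \<longlonglongrightarrow> l" for i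
  proof -
    have "Cauchy (\<lambda>n. ell2_coeff (X n) i)"
    proof (rule metric_CauchyI)
      fix e :: real assume "e > 0"
      then obtain M where M: "\<forall>m\<ge>M. \<forall>n\<ge>M. dist (X m) (X n) < e"
        using metric_CauchyD[OF X] by blast
      have "dist (ell2_coeff (X m) i) (ell2_coeff (X n) i) \<le> dist (X m) (X n)" for m n
        using norm_ell2_coeff_le[of "X m - X n" i] by (simp add: dist_norm ell2_coeff_diff)
      then show "\<exists>M. \<forall>m\<ge>M. \<forall>n\<ge>M. dist (ell2_coeff (X m) i) (ell2_coeff (X n) i) < e"
        using M by (meson le_less_trans)
    qed
    then show ?thesis
      using Cauchy_convergent_iff convergent_def by blast
  qed
  then obtain x where x: "\<And>i. (\<lambda>n. ell2_coeff (X n) i) \<longlonglongrightarrow> x i"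
    by metis
  have fin: "\<exists>N. \<forall>n\<ge>N. \<forall>F. finite F \<longrightarrow> (\<Sum>i\<in>F. (cmod (ell2_coeff (X n) i - x i))\<^sup>2) \<le> e\<^sup>2"
    if "e > 0" for e :: real
  proof -
    obtain N where N: "\<forall>m\<ge>N. \<forall>n\<ge>N. dist (X m) (X n) < e"
      using metric_CauchyD[OF X \<open>e > 0\<close>] by blast
    have "(\<Sum>i\<in>F. (cmod (ell2_coeff (X n) i - x i))\<^sup>2) \<le> e\<^sup>2" if n: "n \<ge> N" and F: "finite F" for n F
    proof (rule LIMSEQ_le_const2)
      show "(\<lambda>m. \<Sum>i\<in>F. (cmod (ell2_coeff (X n) i - ell2_coeff (X m) i))\<^sup>2)
          \<longlonglongrightarrow> (\<Sum>i\<in>F. (cmod (ell2_coeff (X n) i - x i))\<^sup>2)"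
        by (intro tendsto_intros x)
      have "(\<Sum>i\<in>F. (cmod (ell2_coeff (X n) i - ell2_coeff (X m) i))\<^sup>2) \<le> e\<^sup>2" if m: "m \<ge> N" for m
      proof -
        have "(\<Sum>i\<in>F. (cmod (ell2_coeff (X n - X m) i))\<^sup>2) \<le> (norm (X n - X m))\<^sup>2"
          unfolding norm_ell2_sq using ell2_coeff[of "X n - X m"] F
          by (intro finite_sum_le_infsum) auto
        also have "\<dots> \<le> e\<^sup>2"
          using N n m by (intro power_mono) (auto simp: dist_norm less_imp_le)
        finally show ?thesis
          by (simp add: ell2_coeff_diff)
      qed
      then show "\<exists>M. \<forall>m\<ge>M. (\<Sum>i\<in>F. (cmod (ell2_coeff (X n) i - ell2_coeff (X m) i))\<^sup>2) \<le> e\<^sup>2"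
        by blast
    qed
    then show ?thesis by blast
  qed
  have sum: "\<exists>N. \<forall>n\<ge>N. (\<lambda>i. (cmod (ell2_coeff (X n) i - x i))\<^sup>2) summable_on UNIV" 
  proof -
    obtain N where N: "\<forall>n\<ge>N. \<forall>F. finite F \<longrightarrow> (\<Sum>i\<in>F. (cmod (ell2_coeff (X n) i - x i))\<^sup>2) \<le> 1\<^sup>2"
      using fin[of 1] by auto
    then show ?thesis
      by (intro exI[of _ N] allI impI nonneg_bdd_above_summable_on bdd_aboveI2[where M = "1\<^sup>2"]) auto
  qed
  then obtain N0 where N0: "\<And>n. n \<ge> N0 \<Longrightarrow> (\<lambda>i. (cmod (ell2_coeff (X n) i - x i))\<^sup>2) summable_on UNIV"
    by blast
  have "(\<lambda>i. (cmod (ell2_coeff (X N0) i + - (ell2_coeff (X N0) i - x i)))\<^sup>2) summable_on UNIV"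
    using N0[of N0] ell2_coeff[of "X N0"] by (intro sq_summable_add) (auto simp: norm_minus_commute)
  then obtain l where l: "ell2_coeff l = x"
    by (metis (no_types, lifting) Abs_ell2_inverse mem_Collect_eq add.right_neutral add_diff_cancel_left' 
        diff_add_cancel ext minus_diff_eq uminus_add_conv_diff summable_on_cong)
  have "X \<longlonglongrightarrow> l"
  proof (rule metric_LIMSEQ_I)
    fix r :: real assume r: "r > 0"
    obtain N where N: "\<forall>n\<ge>N. \<forall>F. finite F \<longrightarrow> (\<Sum>i\<in>F. (cmod (ell2_coeff (X n) i - x i))\<^sup>2) \<le> (r/2)\<^sup>2"
      using fin[of "r/2"] r by auto
    have "dist (X n) l < r" if "n \<ge> max N N0" for n
    proof -
      have "(norm (X n - l))\<^sup>2 \<le> (r/2)\<^sup>2"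
        unfolding norm_ell2_sq ell2_coeff_diff l using N N0 that
        by (intro infsum_le_finite_sums) auto
      then have "norm (X n - l) \<le> r/2"
        using r by (simp add: power2_le_iff_abs_le)
      then show ?thesis
        using r by (simp add: dist_norm)
    qed
    then show "\<exists>N. \<forall>n\<ge>N. dist (X n) l < r"
      by blast
  qed
  then show "convergent X"
    by (auto simp: convergent_def)
qed

lift_definition ell2_unit :: "'i \<Rightarrow> 'i ell2" is "\<lambda>i j. if j = i then 1 else 0"
proof -
  fix i :: 'i
  have "(\<lambda>j. (cmod (if j = i then 1 else 0))\<^sup>2) summable_on {i}"
    by simp
  then show "(\<lambda>j. (cmod (if j = i then 1 else 0))\<^sup>2) summable_on UNIV"
    by (rule summable_on_cong_neutral[THEN iffD1, rotated -1]) auto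
qed

lemma ell2_coeff_unit: "ell2_coeff (ell2_unit i) j = (if j = i then 1 else 0)"
  by transfer simp

lemma ell2_coeff_sum: "ell2_coeff (\<Sum>k\<in>F. f k) i = (\<Sum>k\<in>F. ell2_coeff (f k) i)"
proof (induction F rule: infinite_finite_induct)
  case (insert k F)
  then show ?case by (simp add: plus_ell2.rep_eq)
qed (simp_all add: zero_ell2.rep_eq)

lemma norm_ell2_unit: "norm (ell2_unit i) = 1"
proof -
  have "(norm (ell2_unit i))\<^sup>2 = (\<Sum>\<^sub>\<infinity>j\<in>{i}. (cmod (ell2_coeff (ell2_unit i) j))\<^sup>2)"
    unfolding norm_ell2_sq by (rule infsum_cong_neutral) (auto simp: ell2_coeff_unit)
  then have "(norm (ell2_unit i))\<^sup>2 = 1\<^sup>2"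
    by (simp add: ell2_coeff_unit)
  then show ?thesis
    by (subst (asm) power2_eq_iff_nonneg) auto
qed

lemma ell2_finite_approx:
  assumes "e > 0"
  obtains F where "finite F" "norm (x - (\<Sum>i\<in>F. ell2_coeff x i *\<^sub>C ell2_unit i)) < e"
proof -
  define f where "f = (\<lambda>i. (cmod (ell2_coeff x i))\<^sup>2)"
  have f: "f summable_on UNIV"
    unfolding f_def using ell2_coeff[of x] by simp
  have "\<forall>\<^sub>F F in finite_subsets_at_top UNIV. dist (sum f F) (infsum f UNIV) < e\<^sup>2"
    using has_sum_infsum[OF f] assms unfolding has_sum_def by (intro tendstoD) auto
  then obtain F where F: "finite F" "dist (sum f F) (infsum f UNIV) < e\<^sup>2"
    unfolding eventually_finite_subsets_at_top by blast
  define y where "y = (\<Sum>i\<in>F. ell2_coeff x i *\<^sub>C ell2_unit i)"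
  have y: "ell2_coeff y i = (if i \<in> F then ell2_coeff x i else 0)" for i
    using F by (simp add: y_def ell2_coeff_sum scaleC_ell2.rep_eq ell2_coeff_unit sum.delta if_distrib
        cong: if_cong)
  have "(norm (x - y))\<^sup>2 = infsum f (UNIV - F)"
    unfolding norm_ell2_sq f_def
    by (rule infsum_cong_neutral) (auto simp: ell2_coeff_diff y)
  also have "\<dots> = infsum f UNIV - infsum f F"
    using F f by (intro infsum_Diff) auto
  also have "\<dots> < e\<^sup>2"
    using F by (simp add: dist_real_def)
  finally have "norm (x - y) < e"
    using assms by (simp add: power2_less_imp_less)
  then show ?thesis
    using that F unfolding y_def by blast
qed

instance ell2 :: (countable) second_countable_topology
proof
  define D where "D = range (\<lambda>xs :: ('a \<times> rat \<times> rat) list.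
      \<Sum>(i, a, b)\<leftarrow>xs. Complex (of_rat a) (of_rat b) *\<^sub>C ell2_unit i)"
  define B where "B = (\<lambda>(d, n). ball d (inverse (real (Suc n)))) ` (D \<times> (UNIV :: nat set))"
  have dense: "\<exists>d\<in>D. dist d x < e" if e: "e > 0" for x :: "'a ell2" and e :: real
  proof -
    obtain F where F: "finite F" "norm (x - (\<Sum>i\<in>F. ell2_coeff x i *\<^sub>C ell2_unit i)) < e / 2"
      using ell2_finite_approx[of "e / 2" x] e by auto
    define \<delta> where "\<delta> = e / (4 * (real (card F) + 1))"
    have \<delta>: "\<delta> > 0"
      using e by (simp add: \<delta>_def)
    have "\<exists>q. \<bar>of_rat q - r\<bar> < \<delta>" for r :: real
    proof -
      obtain q where "r - \<delta> < of_rat q" "of_rat q < r + \<delta>"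
        using of_rat_dense[of "r - \<delta>" "r + \<delta>"] \<delta> by auto
      then show ?thesis
        by (intro exI[of _ q]) auto
    qed
    then obtain q where q: "\<And>r :: real. \<bar>of_rat (q r) - r\<bar> < \<delta>"
      by metis
    define c where "c z = Complex (of_rat (q (Re z))) (of_rat (q (Im z)))" for z
    have c: "cmod (z - c z) \<le> 2 * \<delta>" for z
    proof -
      have "cmod (z - c z) \<le> \<bar>Re (z - c z)\<bar> + \<bar>Im (z - c z)\<bar>"
        by (rule cmod_le)
      also have "\<dots> \<le> \<delta> + \<delta>"
        using q[of "Re z"] q[of "Im z"] by (intro add_mono) (auto simp: c_def abs_minus_commute)
      finally show ?thesis by simp
    qed
    define d where "d = (\<Sum>i\<in>F. c (ell2_coeff x i) *\<^sub>C ell2_unit i)"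
    obtain ks where ks: "set ks = F" "distinct ks"
      using finite_distinct_list[OF F(1)] by blast
    have "d = (\<Sum>(i, a, b)\<leftarrow>map (\<lambda>i. (i, q (Re (ell2_coeff x i)), q (Im (ell2_coeff x i)))) ks.
        Complex (of_rat a) (of_rat b) *\<^sub>C ell2_unit i)"
      unfolding d_def ks(1)[symmetric] sum.distinct_set_conv_list[OF ks(2)]
      by (simp add: c_def o_def)
    then have "d \<in> D"
      unfolding D_def by blast
    have "norm ((\<Sum>i\<in>F. ell2_coeff x i *\<^sub>C ell2_unit i) - d)
        = norm (\<Sum>i\<in>F. (ell2_coeff x i - c (ell2_coeff x i)) *\<^sub>C ell2_unit i)"
    proof -
      have "(a - b) *\<^sub>C v = a *\<^sub>C v - b *\<^sub>C v" for a b and v :: "'a ell2"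
        by (metis scaleC_add_left add_diff_cancel_right' diff_add_cancel)
      then show ?thesis
        by (simp add: d_def sum_subtractf)
    qed
    also have "\<dots> \<le> (\<Sum>i\<in>F. 2 * \<delta>)"
      by (rule sum_norm_le) (simp add: norm_scaleC norm_ell2_unit c)
    also have "\<dots> < e / 2"
      using e by (simp add: \<delta>_def field_simps)
    finally have "norm (x - (\<Sum>i\<in>F. ell2_coeff x i *\<^sub>C ell2_unit i) + ((\<Sum>i\<in>F. ell2_coeff x i *\<^sub>C ell2_unit i) - d)) < e"
      using F(2) norm_triangle_ineq[of "x - (\<Sum>i\<in>F. ell2_coeff x i *\<^sub>C ell2_unit i)"
          "(\<Sum>i\<in>F. ell2_coeff x i *\<^sub>C ell2_unit i) - d"] by linarith
    then show ?thesis
      using \<open>d \<in> D\<close> by (intro bexI[of _ d]) (auto simp: dist_norm norm_minus_commute)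
  qed
  have "topological_basis B"
  proof (rule topological_basisI)
    show "open S" if "S \<in> B" for S
      using that by (auto simp: B_def)
    fix S :: "'a ell2 set" and x assume S: "open S" "x \<in> S"
    then obtain e where e: "e > 0" "ball x e \<subseteq> S"
      by (meson openE)
    obtain n where n: "inverse (real (Suc n)) < e / 2"
      using reals_Archimedean[of "e / 2"] e by auto
    obtain d where d: "d \<in> D" "dist d x < inverse (real (Suc n))"
      using dense[of "inverse (real (Suc n))" x] by auto
    have "ball d (inverse (real (Suc n))) \<subseteq> ball x e"
    proof
      fix y assume "y \<in> ball d (inverse (real (Suc n)))"
      then have "dist d y < inverse (real (Suc n))"
        by simp
      then show "y \<in> ball x e"
        using d n dist_triangle[of x y d] by (simp add: dist_commute)
    qed
    then show "\<exists>B'\<in>B. x \<in> B' \<and> B' \<subseteq> S"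
      using d e by (intro bexI[of _ "ball d (inverse (real (Suc n)))"]) (auto simp: B_def)
  qed
  moreover have "countable B"
    by (simp add: B_def D_def)
  ultimately show "\<exists>B :: 'a ell2 set set. countable B \<and> open = generate_topology B"
    using topological_basis_imp_subbasis by blast
qed


instance chilbert_space \<subseteq> banach ..

section \<open>Square-integrable functions on the torus\<close>

text \<open>
  The unit circle carries normalized Lebesgue measure, the image of the uniform distribution of the
  angle. Elements of the space below are functions on \<^typ>\<open>complex \<times> complex\<close> modulo equality almost
  everywhere on the torus; values off the torus are immaterial.
\<close>

definition circle_measure :: "complex measure" where
  "circle_measure =
     distr (uniform_measure lborel {0..<2 * pi}) (restrict_space borel (sphere 0 1)) cis"

definition torus_measure :: "(complex \<times> complex) measure" where
  "torus_measure = circle_measure \<Otimes>\<^sub>M circle_measure"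

definition square_integrable_torus ::
    "(complex \<times> complex \<Rightarrow> 'b :: {chilbert_space, second_countable_topology}) \<Rightarrow> bool" where
  "square_integrable_torus f \<longleftrightarrow>
     f \<in> borel_measurable torus_measure \<and> integrable torus_measure (\<lambda>z. (norm (f z))\<^sup>2)"

lemma space_circle_measure [simp]: "space circle_measure = sphere 0 1"
  by (simp add: circle_measure_def space_restrict_space)

lemma space_torus_measure: "space torus_measure = sphere 0 1 \<times> sphere 0 1"
  by (simp add: torus_measure_def space_pair_measure)

lemma prob_space_circle_measure: "prob_space circle_measure"
  unfolding circle_measure_def
proof (rule prob_space.prob_space_distr)
  show "prob_space (uniform_measure lborel {0..<2 * pi})"
    by (rule prob_space_uniform_measure) auto
  show "cis \<in> uniform_measure lborel {0..<2 * pi} \<rightarrow>\<^sub>M restrict_space borel (sphere 0 1)"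
  proof (rule measurable_restrict_space2)
    have "cis \<in> borel_measurable borel"
      by (intro borel_measurable_continuous_onI continuous_intros)
    then show "cis \<in> borel_measurable (uniform_measure lborel {0..<2 * pi})"
      by simp
  qed simp
qed

lemma prob_space_torus_measure: "prob_space torus_measure"
  unfolding torus_measure_def by (intro prob_space_pair prob_space_circle_measure)

lemma measurable_fst_torus [measurable]: "fst \<in> borel_measurable torus_measure"
  and measurable_snd_torus [measurable]: "snd \<in> borel_measurable torus_measure"
proof -
  have id: "(\<lambda>z. z) \<in> borel_measurable circle_measure"
    unfolding circle_measure_def by (simp add: measurable_restrict_space1)
  show "fst \<in> borel_measurable torus_measure"
    unfolding torus_measure_def by (rule measurable_compose[OF measurable_fst id])
  show "snd \<in> borel_measurable torus_measure"
    unfolding torus_measure_def by (rule measurable_compose[OF measurable_snd id])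
qed

lemma borel_measurable_scaleC [measurable (raw)]:
  fixes f :: "'m \<Rightarrow> 'b :: {chilbert_space, second_countable_topology}"
  assumes [measurable]: "c \<in> borel_measurable M" "f \<in> borel_measurable M"
  shows "(\<lambda>z. c z *\<^sub>C f z) \<in> borel_measurable M"
proof -
  have eq: "c *\<^sub>C x = Re c *\<^sub>R x + Im c *\<^sub>R (\<i> *\<^sub>C x)" for c and x :: 'b
  proof -
    have "c = complex_of_real (Re c) + complex_of_real (Im c) * \<i>"
      by (simp add: complex_eq_iff)
    then have "c *\<^sub>C x = (complex_of_real (Re c) + complex_of_real (Im c) * \<i>) *\<^sub>C x"
      by simp
    then show ?thesis
      by (simp only: scaleC_add_left scaleC_scaleC[symmetric] scaleC_of_real)
  qed
  have "(\<lambda>z. \<i> *\<^sub>C f z) \<in> borel_measurable M"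
    by (rule measurable_compose[OF assms(2)], intro borel_measurable_continuous_onI
        linear_continuous_on bounded_linear_scaleC)
  then show ?thesis
    unfolding eq[of "c _"] by measurable
qed

lemma borel_measurable_cinner [measurable (raw)]:
  fixes f g :: "'m \<Rightarrow> 'b :: {chilbert_space, second_countable_topology}"
  assumes [measurable]: "f \<in> borel_measurable M" "g \<in> borel_measurable M"
  shows "(\<lambda>z. cinner (f z) (g z)) \<in> borel_measurable M"
  unfolding cinner_eq_inner Complex_eq by measurable

lemma square_integrable_torus_measurable [measurable_dest]:
  "square_integrable_torus f \<Longrightarrow> f \<in> borel_measurable torus_measure"
  by (simp add: square_integrable_torus_def)

lemma square_integrable_torus_add:
  assumes "square_integrable_torus f" "square_integrable_torus g"
  shows "square_integrable_torus (\<lambda>z. f z + g z)"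
proof -
  note [measurable] = assms[THEN square_integrable_torus_measurable]
  have "integrable torus_measure (\<lambda>z. (norm (f z + g z))\<^sup>2)"
  proof (rule Bochner_Integration.integrable_bound)
    show "integrable torus_measure (\<lambda>z. 2 * (norm (f z))\<^sup>2 + 2 * (norm (g z))\<^sup>2)"
      using assms by (auto simp: square_integrable_torus_def)
    have "(norm (f z + g z))\<^sup>2 \<le> 2 * (norm (f z))\<^sup>2 + 2 * (norm (g z))\<^sup>2" for z
    proof -
      have "(norm (f z + g z))\<^sup>2 \<le> (norm (f z) + norm (g z))\<^sup>2"
        by (simp add: norm_triangle_ineq power_mono)
      also have "\<dots> \<le> 2 * (norm (f z))\<^sup>2 + 2 * (norm (g z))\<^sup>2"
        using zero_le_power2[of "norm (f z) - norm (g z)"] by (simp add: power2_eq_square algebra_simps)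
      finally show ?thesis .
    qed
    then show "AE z in torus_measure. norm ((norm (f z + g z))\<^sup>2)
        \<le> norm (2 * (norm (f z))\<^sup>2 + 2 * (norm (g z))\<^sup>2)"
      by simp
  qed measurable
  then show ?thesis
    by (simp add: square_integrable_torus_def)
qed

lemma square_integrable_torus_multiplier:
  assumes "square_integrable_torus f" and [measurable]: "c \<in> borel_measurable torus_measure"
    and "\<And>z. z \<in> space torus_measure \<Longrightarrow> cmod (c z) \<le> K"
  shows "square_integrable_torus (\<lambda>z. c z *\<^sub>C f z)"
proof -
  note [measurable] = assms(1)[THEN square_integrable_torus_measurable]
  have "integrable torus_measure (\<lambda>z. (norm (c z *\<^sub>C f z))\<^sup>2)"
  proof (rule Bochner_Integration.integrable_bound)
    show "integrable torus_measure (\<lambda>z. K\<^sup>2 * (norm (f z))\<^sup>2)"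
      using assms(1) by (auto simp: square_integrable_torus_def)
    show "AE z in torus_measure. norm ((norm (c z *\<^sub>C f z))\<^sup>2) \<le> norm (K\<^sup>2 * (norm (f z))\<^sup>2)"
      using assms(3) by (intro AE_I2) (auto simp: norm_scaleC power_mult_distrib intro!: mult_right_mono power_mono)
  qed measurable
  then show ?thesis
    by (simp add: square_integrable_torus_def)
qed

lemma square_integrable_torus_scaleC:
  "square_integrable_torus f \<Longrightarrow> square_integrable_torus (\<lambda>z. c *\<^sub>C f z)"
  by (rule square_integrable_torus_multiplier[where c = "\<lambda>_. c" and K = "cmod c"]) auto

lemma square_integrable_torus_scaleR:
  "square_integrable_torus f \<Longrightarrow> square_integrable_torus (\<lambda>z. r *\<^sub>R f z)"
  using square_integrable_torus_scaleC[of f "complex_of_real r"] by (simp only: scaleC_of_real)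

lemma square_integrable_torus_minus:
  "square_integrable_torus f \<Longrightarrow> square_integrable_torus (\<lambda>z. - f z)"
  using square_integrable_torus_scaleC[of f "- 1"] by (simp only: scaleC_minus1)

lemma square_integrable_torus_diff:
  "square_integrable_torus f \<Longrightarrow> square_integrable_torus g \<Longrightarrow> square_integrable_torus (\<lambda>z. f z - g z)"
  using square_integrable_torus_add[OF _ square_integrable_torus_minus, of f g] by simp

lemma square_integrable_torus_const: "square_integrable_torus (\<lambda>_. x)"
  using prob_space_torus_measure
  by (simp add: square_integrable_torus_def prob_space.finite_measure finite_measure.integrable_const)

lemma integrable_cinner_torus:
  assumes "square_integrable_torus f" "square_integrable_torus g"
  shows "integrable torus_measure (\<lambda>z. cinner (f z) (g z))"
proof (rule Bochner_Integration.integrable_bound)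
  note [measurable] = assms[THEN square_integrable_torus_measurable]
  show "(\<lambda>z. cinner (f z) (g z)) \<in> borel_measurable torus_measure"
    by measurable
  show "integrable torus_measure (\<lambda>z. (norm (f z))\<^sup>2 + (norm (g z))\<^sup>2)"
    using assms by (auto simp: square_integrable_torus_def)
  have "norm (cinner (f z) (g z)) \<le> (norm (f z))\<^sup>2 + (norm (g z))\<^sup>2" for z
    using norm_cinner_le[of "f z" "g z"] sum_squares_bound[of "norm (f z)" "norm (g z)"]
      mult_nonneg_nonneg[OF norm_ge_zero norm_ge_zero, of "f z" "g z"] by linarith
  then show "AE z in torus_measure. norm (cinner (f z) (g z)) \<le> norm ((norm (f z))\<^sup>2 + (norm (g z))\<^sup>2)"
    by simp
qed

definition torus_L2_rel ::
    "(complex \<times> complex \<Rightarrow> 'b :: {chilbert_space, second_countable_topology}) \<Rightarrow> _ \<Rightarrow> bool" where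
  "torus_L2_rel f g \<longleftrightarrow> square_integrable_torus f \<and> square_integrable_torus g \<and>
     (AE z in torus_measure. f z = g z)"

quotient_type (overloaded) 'b torus_L2 =
  "complex \<times> complex \<Rightarrow> 'b :: {chilbert_space, second_countable_topology}" / partial: torus_L2_rel
proof (rule part_equivpI)
  show "\<exists>f :: complex \<times> complex \<Rightarrow> 'b. torus_L2_rel f f"
    using square_integrable_torus_const[of 0] by (auto simp: torus_L2_rel_def)
  show "symp (torus_L2_rel :: (complex \<times> complex \<Rightarrow> 'b) \<Rightarrow> _)"
    by (auto simp: torus_L2_rel_def symp_def elim: eventually_mono)
  show "transp (torus_L2_rel :: (complex \<times> complex \<Rightarrow> 'b) \<Rightarrow> _)"
    by (auto simp: torus_L2_rel_def transp_def elim: eventually_elim2)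
qed

instantiation torus_L2 :: ("{chilbert_space, second_countable_topology}") real_vector
begin

lift_definition zero_torus_L2 :: "'a torus_L2" is "\<lambda>_. 0"
  by (simp add: torus_L2_rel_def square_integrable_torus_const)

lift_definition plus_torus_L2 :: "'a torus_L2 \<Rightarrow> 'a torus_L2 \<Rightarrow> 'a torus_L2" is "\<lambda>f g z. f z + g z"
  by (auto simp: torus_L2_rel_def square_integrable_torus_add elim: eventually_elim2)

lift_definition scaleR_torus_L2 :: "real \<Rightarrow> 'a torus_L2 \<Rightarrow> 'a torus_L2" is "\<lambda>r f z. r *\<^sub>R f z"
  by (auto simp: torus_L2_rel_def square_integrable_torus_scaleR elim: eventually_mono)

lift_definition uminus_torus_L2 :: "'a torus_L2 \<Rightarrow> 'a torus_L2" is "\<lambda>f z. - f z"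
  by (auto simp: torus_L2_rel_def square_integrable_torus_minus elim: eventually_mono)

lift_definition minus_torus_L2 :: "'a torus_L2 \<Rightarrow> 'a torus_L2 \<Rightarrow> 'a torus_L2" is "\<lambda>f g z. f z - g z"
  by (auto simp: torus_L2_rel_def square_integrable_torus_diff elim: eventually_elim2)

instance
proof
  fix x y z :: "'a torus_L2" and r s :: real
  show "x + y + z = x + (y + z)"
    by transfer (auto simp: torus_L2_rel_def add.assoc square_integrable_torus_add)
  show "x + y = y + x"
    by transfer (auto simp: torus_L2_rel_def add.commute square_integrable_torus_add)
  show "0 + x = x"
    by transfer (auto simp: torus_L2_rel_def)
  show "- x + x = 0"
    by transfer (auto simp: torus_L2_rel_def square_integrable_torus_const)
  show "x - y = x + - y"
    by transfer (auto simp: torus_L2_rel_def square_integrable_torus_diff)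
  show "r *\<^sub>R (x + y) = r *\<^sub>R x + r *\<^sub>R y"
    by transfer (auto simp: torus_L2_rel_def scaleR_add_right square_integrable_torus_add
        square_integrable_torus_scaleR)
  show "(r + s) *\<^sub>R x = r *\<^sub>R x + s *\<^sub>R x"
    by transfer (auto simp: torus_L2_rel_def scaleR_add_left square_integrable_torus_add
        square_integrable_torus_scaleR)
  show "r *\<^sub>R s *\<^sub>R x = (r * s) *\<^sub>R x"
    by transfer (auto simp: torus_L2_rel_def square_integrable_torus_scaleR)
  show "1 *\<^sub>R x = x"
    by transfer (auto simp: torus_L2_rel_def)
qed

end

instantiation torus_L2 :: ("{chilbert_space, second_countable_topology}") complex_inner
begin

lift_definition scaleC_torus_L2 :: "complex \<Rightarrow> 'a torus_L2 \<Rightarrow> 'a torus_L2" is "\<lambda>c f z. c *\<^sub>C f z"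
  by (auto simp: torus_L2_rel_def square_integrable_torus_scaleC elim: eventually_mono)

lift_definition cinner_torus_L2 :: "'a torus_L2 \<Rightarrow> 'a torus_L2 \<Rightarrow> complex"
  is "\<lambda>f g. \<integral>z. cinner (f z) (g z) \<partial>torus_measure"
  unfolding torus_L2_rel_def
  by (intro integral_cong_AE) (auto elim: eventually_elim2)

definition inner_torus_L2 :: "'a torus_L2 \<Rightarrow> 'a torus_L2 \<Rightarrow> real"
  where "inner_torus_L2 x y = Re (cinner x y)"

definition norm_torus_L2 :: "'a torus_L2 \<Rightarrow> real"
  where "norm_torus_L2 x = sqrt (inner x x)"

definition dist_torus_L2 :: "'a torus_L2 \<Rightarrow> 'a torus_L2 \<Rightarrow> real"
  where "dist_torus_L2 x y = norm (x - y)"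

definition sgn_torus_L2 :: "'a torus_L2 \<Rightarrow> 'a torus_L2"
  where "sgn_torus_L2 x = x /\<^sub>R norm x"

definition uniformity_torus_L2 :: "('a torus_L2 \<times> 'a torus_L2) filter"
  where "uniformity_torus_L2 = (INF e\<in>{0<..}. principal {(x, y). dist x y < e})"

definition open_torus_L2 :: "'a torus_L2 set \<Rightarrow> bool"
  where "open_torus_L2 U \<longleftrightarrow> (\<forall>x\<in>U. \<forall>\<^sub>F (x', y) in uniformity. x' = x \<longrightarrow> y \<in> U)"

instance
proof
  fix x y z :: "'a torus_L2" and c d :: complex and r :: real and U :: "'a torus_L2 set"
  show "c *\<^sub>C (x + y) = c *\<^sub>C x + c *\<^sub>C y"
    by transfer (auto simp: torus_L2_rel_def scaleC_add_right square_integrable_torus_add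
        square_integrable_torus_scaleC)
  show "(c + d) *\<^sub>C x = c *\<^sub>C x + d *\<^sub>C x"
    by transfer (auto simp: torus_L2_rel_def scaleC_add_left square_integrable_torus_add
        square_integrable_torus_scaleC)
  show "c *\<^sub>C d *\<^sub>C x = (c * d) *\<^sub>C x"
    by transfer (auto simp: torus_L2_rel_def scaleC_scaleC square_integrable_torus_scaleC)
  show of_real: "complex_of_real r *\<^sub>C x = r *\<^sub>R x" for r and x :: "'a torus_L2"
    by transfer (auto simp: torus_L2_rel_def scaleC_of_real square_integrable_torus_scaleR)
  show com: "cinner x y = cnj (cinner y x)" for x y :: "'a torus_L2"
    by transfer
      (simp only: Bochner_Integration.integral_cnj[symmetric] cinner_commute[symmetric])
  show add: "cinner (x + y) z = cinner x z + cinner y z"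
    by transfer (simp add: torus_L2_rel_def cinner_add_left integrable_cinner_torus)
  show scale: "cinner (c *\<^sub>C x) y = c * cinner x y" for c
    by transfer (simp add: cinner_scaleC_left)
  show "inner x y = Re (cinner x y)" "norm x = sqrt (inner x x)" "dist x y = norm (x - y)"
    "sgn x = x /\<^sub>R norm x"
    "(uniformity :: ('a torus_L2 \<times> 'a torus_L2) filter) = (INF e\<in>{0<..}. principal {(x, y). dist x y < e})"
    "open U \<longleftrightarrow> (\<forall>x\<in>U. \<forall>\<^sub>F (x', y) in uniformity. x' = x \<longrightarrow> y \<in> U)"
    by (rule inner_torus_L2_def norm_torus_L2_def dist_torus_L2_def sgn_torus_L2_def
        uniformity_torus_L2_def open_torus_L2_def)+
  show "inner x y = inner y x"
    unfolding inner_torus_L2_def using com[of x y] by simp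
  show "inner (x + y) z = inner x z + inner y z"
    unfolding inner_torus_L2_def using add by simp
  show "inner (r *\<^sub>R x) y = r * inner x y"
    unfolding inner_torus_L2_def of_real[symmetric] using scale by simp
  have sq: "Re (\<integral>z. cinner (f z) (f z) \<partial>torus_measure) = (\<integral>z. (norm (f z))\<^sup>2 \<partial>torus_measure)"
    for f :: "complex \<times> complex \<Rightarrow> 'a"
    by (simp only: cinner_self integral_complex_of_real Re_complex_of_real)
  show "0 \<le> inner x x"
    unfolding inner_torus_L2_def by transfer (simp add: sq)
  show "(inner x x = 0) = (x = 0)"
    unfolding inner_torus_L2_def
  proof transfer
    fix f :: "complex \<times> complex \<Rightarrow> 'a"
    assume "torus_L2_rel f f"
    then have f: "square_integrable_torus f"
      by (simp add: torus_L2_rel_def)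
    then have "(\<integral>z. (norm (f z))\<^sup>2 \<partial>torus_measure) = 0 \<longleftrightarrow> (AE z in torus_measure. (norm (f z))\<^sup>2 = 0)"
      by (intro integral_nonneg_eq_0_iff_AE) (auto simp: square_integrable_torus_def)
    then show "(Re (\<integral>z. cinner (f z) (f z) \<partial>torus_measure) = 0) = torus_L2_rel f (\<lambda>_. 0)"
      by (simp add: sq torus_L2_rel_def f square_integrable_torus_const)
  qed
qed

end

lemma norm_torus_L2_sq:
  assumes "square_integrable_torus f"
  shows "(norm (abs_torus_L2 f))\<^sup>2 = (\<integral>z. (norm (f z))\<^sup>2 \<partial>torus_measure)"
proof -
  have "cinner (abs_torus_L2 f) (abs_torus_L2 f) = (\<integral>z. cinner (f z) (f z) \<partial>torus_measure)"
    using assms by (intro cinner_torus_L2.abs_eq) (simp_all add: torus_L2_rel_def)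
  then show ?thesis
    unfolding cinner_self by (simp del: of_real_power)
qed

lemma torus_L2_cases:
  obtains f where "square_integrable_torus f" "F = abs_torus_L2 f"
  by (rule that[of "rep_torus_L2 F"])
    (use Quotient3_rep_reflp[OF Quotient3_torus_L2, of F] Quotient3_abs_rep[OF Quotient3_torus_L2, of F]
      in \<open>auto simp: torus_L2_rel_def\<close>)

lemma abs_torus_L2_diff:
  assumes "square_integrable_torus f" "square_integrable_torus g"
  shows "abs_torus_L2 f - abs_torus_L2 g = abs_torus_L2 (\<lambda>z. f z - g z)"
  using assms by (intro minus_torus_L2.abs_eq) (simp_all add: torus_L2_rel_def)

instance torus_L2 :: ("{chilbert_space, second_countable_topology}") chilbert_space
proof
  fix X :: "nat \<Rightarrow> 'a torus_L2"
  assume X: "Cauchy X"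
  let ?M = torus_measure
  interpret prob_space ?M
    by (rule prob_space_torus_measure)
  have "\<exists>N. \<forall>m\<ge>N. \<forall>n\<ge>N. norm (X m - X n) < (1/2) ^ k" for k :: nat
    using metric_CauchyD[OF X, of "(1/2) ^ k"] by (simp add: dist_norm)
  then obtain N where N: "\<And>k m n. m \<ge> N k \<Longrightarrow> n \<ge> N k \<Longrightarrow> norm (X m - X n) < (1/2) ^ k"
    by metis
  define r where "r k = k + (\<Sum>j\<le>k. N j)" for k
  have r: "strict_mono r"
    by (rule strict_monoI_Suc) (simp add: r_def)
  have rN: "r k \<ge> N k" for k
    using member_le_sum[of k "{..k}" N] by (simp add: r_def)
  have "\<exists>f. square_integrable_torus f \<and> X (r k) = abs_torus_L2 f" for k
    by (metis torus_L2_cases)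
  then obtain g where g: "\<And>k. square_integrable_torus (g k)" "\<And>k. X (r k) = abs_torus_L2 (g k)"
    by metis
  note [measurable] = g(1)[THEN square_integrable_torus_measurable]
  have int: "(\<integral>z. (norm (g l z - g k z))\<^sup>2 \<partial>?M) \<le> ((1/2) ^ k)\<^sup>2" if "l \<ge> k" for k l
  proof -
    have "r l \<ge> N k"
      using rN[of k] strict_mono_less_eq[OF r, of k l] that by simp
    then have "(norm (X (r l) - X (r k)))\<^sup>2 \<le> ((1/2) ^ k)\<^sup>2"
      using N[OF _ rN] by (intro power_mono) (auto simp: less_imp_le)
    then show ?thesis
      by (simp only: g(2) abs_torus_L2_diff[OF g(1) g(1)]
          norm_torus_L2_sq[OF square_integrable_torus_diff[OF g(1) g(1)]])
  qed
  have integrable: "integrable ?M (\<lambda>z. (norm (g l z - g k z))\<^sup>2)" for k l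
    using square_integrable_torus_diff[OF g(1) g(1), of l k] by (simp add: square_integrable_torus_def)
  have nn: "(\<integral>\<^sup>+z. ennreal (norm (g (Suc k) z - g k z)) \<partial>?M) \<le> ennreal ((1/2) ^ k)" for k
  proof -
    have le: "t \<le> (2 ^ k * t\<^sup>2 + (1/2) ^ k) / 2" for t :: real
      using zero_le_power2[of "2 ^ k * t - 1"] 
      by (simp add: power2_eq_square field_simps power_one_over)
    have "(\<integral>\<^sup>+z. ennreal (norm (g (Suc k) z - g k z)) \<partial>?M)
        \<le> (\<integral>\<^sup>+z. ennreal ((2 ^ k * (norm (g (Suc k) z - g k z))\<^sup>2 + (1/2) ^ k) / 2) \<partial>?M)"
      by (intro nn_integral_mono ennreal_leI le)
    also have "\<dots> = ennreal (\<integral>z. (2 ^ k * (norm (g (Suc k) z - g k z))\<^sup>2 + (1/2) ^ k) / 2 \<partial>?M)"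
      using integrable by (intro nn_integral_eq_integral) auto
    also have "(\<integral>z. (2 ^ k * (norm (g (Suc k) z - g k z))\<^sup>2 + (1/2) ^ k) / 2 \<partial>?M)
        = (2 ^ k * (\<integral>z. (norm (g (Suc k) z - g k z))\<^sup>2 \<partial>?M) + (1/2) ^ k) / 2"
      using integrable by (simp add: prob_space)
    also have "\<dots> \<le> (2 ^ k * ((1/2) ^ k)\<^sup>2 + (1/2) ^ k) / 2"
      using int[of k "Suc k"] by (intro divide_right_mono add_right_mono mult_left_mono) auto
    also have "\<dots> = (1/2) ^ k"
      by (simp add: power2_eq_square power_one_over)
    finally show ?thesis
      by (simp add: ennreal_leI)
  qed
  have "(\<integral>\<^sup>+z. (\<Sum>k. ennreal (norm (g (Suc k) z - g k z))) \<partial>?M)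
      = (\<Sum>k. \<integral>\<^sup>+z. ennreal (norm (g (Suc k) z - g k z)) \<partial>?M)"
    by (rule nn_integral_suminf) measurable
  also have "\<dots> \<le> (\<Sum>k. ennreal ((1/2) ^ k))"
    by (intro suminf_le nn) auto
  also have "\<dots> = ennreal (\<Sum>k. (1/2) ^ k)"
    by (rule suminf_ennreal2) (auto intro: summable_geometric)
  also have "\<dots> < \<infinity>"
    by simp
  finally have "AE z in ?M. (\<Sum>k. ennreal (norm (g (Suc k) z - g k z))) \<noteq> \<infinity>"
    by (intro nn_integral_PInf_AE) auto
  then have conv: "AE z in ?M. (\<lambda>n. g n z) \<longlonglongrightarrow> lim (\<lambda>n. g n z)"
  proof eventually_elim
    case (elim z)
    then have "summable (\<lambda>k. norm (g (Suc k) z - g k z))"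
      by (intro summable_suminf_not_top) auto
    then have "summable (\<lambda>k. g (Suc k) z - g k z)"
      by (rule summable_norm_cancel)
    then have "convergent (\<lambda>n. (\<Sum>k<n. g (Suc k) z - g k z))"
      by (simp add: summable_iff_convergent)
    then have "convergent (\<lambda>n. g n z - g 0 z)"
      by (simp only: sum_lessThan_telescope[where f = "\<lambda>k. g k z"])
    then have "convergent (\<lambda>n. g n z)"
      using convergent_diff_const_right_iff by blast
    then show ?case
      by (simp add: convergent_LIMSEQ_iff)
  qed
  define G where "G z = lim (\<lambda>n. g n z)" for z
  have [measurable]: "G \<in> borel_measurable ?M"
    unfolding G_def by measurable
  have fatou: "(\<integral>\<^sup>+z. ennreal ((norm (G z - g k z))\<^sup>2) \<partial>?M) \<le> ennreal (((1/2) ^ k)\<^sup>2)" for k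
  proof -
    have "(\<integral>\<^sup>+z. ennreal ((norm (G z - g k z))\<^sup>2) \<partial>?M)
        = (\<integral>\<^sup>+z. liminf (\<lambda>l. ennreal ((norm (g l z - g k z))\<^sup>2)) \<partial>?M)"
    proof (rule nn_integral_cong_AE)
      show "AE z in ?M. ennreal ((norm (G z - g k z))\<^sup>2) = liminf (\<lambda>l. ennreal ((norm (g l z - g k z))\<^sup>2))"
        using conv
      proof eventually_elim
        case (elim z)
        have "(\<lambda>l. ennreal ((norm (g l z - g k z))\<^sup>2)) \<longlonglongrightarrow> ennreal ((norm (G z - g k z))\<^sup>2)"
          unfolding G_def by (intro tendsto_intros elim)
        then show ?case
          by (rule lim_imp_Liminf[OF sequentially_bot, symmetric])
      qed
    qed
    also have "\<dots> \<le> liminf (\<lambda>l. \<integral>\<^sup>+z. ennreal ((norm (g l z - g k z))\<^sup>2) \<partial>?M)"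
      by (rule nn_integral_liminf) measurable
    also have "\<dots> \<le> limsup (\<lambda>l. \<integral>\<^sup>+z. ennreal ((norm (g l z - g k z))\<^sup>2) \<partial>?M)"
      by (rule Liminf_le_Limsup) simp
    also have "\<dots> \<le> ennreal (((1/2) ^ k)\<^sup>2)"
    proof (rule Limsup_bounded)
      show "\<forall>\<^sub>F l in sequentially. (\<integral>\<^sup>+z. ennreal ((norm (g l z - g k z))\<^sup>2) \<partial>?M) \<le> ennreal (((1/2) ^ k)\<^sup>2)"
        using eventually_ge_at_top[of k]
      proof eventually_elim
        case (elim l)
        have "(\<integral>\<^sup>+z. ennreal ((norm (g l z - g k z))\<^sup>2) \<partial>?M) = ennreal (\<integral>z. (norm (g l z - g k z))\<^sup>2 \<partial>?M)"
          using integrable by (intro nn_integral_eq_integral) auto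
        then show ?case
          using int[OF elim] by (simp add: ennreal_leI)
      qed
    qed
    finally show ?thesis .
  qed
  have G_diff: "square_integrable_torus (\<lambda>z. G z - g k z)" for k
  proof -
    have "(\<integral>\<^sup>+z. ennreal (norm ((norm (G z - g k z))\<^sup>2)) \<partial>?M) < \<infinity>"
      using fatou[of k] le_less_trans[OF _ ennreal_less_top] by simp
    then have "integrable ?M (\<lambda>z. (norm (G z - g k z))\<^sup>2)"
      by (intro integrableI_bounded) measurable
    then show ?thesis
      by (simp add: square_integrable_torus_def)
  qed
  have G: "square_integrable_torus G"
    using square_integrable_torus_add[OF G_diff[of 0] g(1)[of 0]] by simp
  have dist: "dist (X (r k)) (abs_torus_L2 G) \<le> (1/2) ^ k" for k
  proof -
    have "ennreal (\<integral>z. (norm (G z - g k z))\<^sup>2 \<partial>?M) \<le> ennreal (((1/2) ^ k)\<^sup>2)"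
      using fatou[of k] G_diff[of k]
      by (subst nn_integral_eq_integral[symmetric]) (auto simp: square_integrable_torus_def)
    then have "(norm (abs_torus_L2 G - X (r k)))\<^sup>2 \<le> ((1/2) ^ k)\<^sup>2"
      by (simp add: g(2) abs_torus_L2_diff G g(1) norm_torus_L2_sq G_diff)
    then show ?thesis
      by (simp add: dist_norm norm_minus_commute power2_le_iff_abs_le)
  qed
  have "(\<lambda>k. dist (X (r k)) (abs_torus_L2 G)) \<longlonglongrightarrow> 0"
    by (rule tendsto_sandwich[OF _ _ tendsto_const LIMSEQ_power_zero[of "1/2 :: real"]])
      (auto simp: dist)
  then have "(X \<circ> r) \<longlonglongrightarrow> abs_torus_L2 G"
    unfolding tendsto_dist_iff[of "X \<circ> r"] by simp
  then have "X \<longlonglongrightarrow> abs_torus_L2 G"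
    by (rule Cauchy_converges_subseq[OF X r])
  then show "convergent X"
    by (auto simp: convergent_def)
qed

lift_definition torus_U1 ::
    "('b :: {chilbert_space, second_countable_topology}) torus_L2 \<Rightarrow> 'b torus_L2"
  is "\<lambda>f z. fst z *\<^sub>C f z"
  by (auto simp: torus_L2_rel_def space_torus_measure elim: eventually_mono
      intro!: square_integrable_torus_multiplier[where K = 1])

lift_definition torus_U2 ::
    "('b :: {chilbert_space, second_countable_topology}) torus_L2 \<Rightarrow> 'b torus_L2"
  is "\<lambda>f z. snd z *\<^sub>C f z"
  by (auto simp: torus_L2_rel_def space_torus_measure elim: eventually_mono
      intro!: square_integrable_torus_multiplier[where K = 1])

lift_definition torus_const ::
    "('b :: {chilbert_space, second_countable_topology}) \<Rightarrow> 'b torus_L2" is "\<lambda>x _. x"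
  by (simp add: torus_L2_rel_def square_integrable_torus_const)

definition ell2_on :: "'i set \<Rightarrow> 'i ell2 set" where
  "ell2_on I = {x. \<forall>i. i \<notin> I \<longrightarrow> ell2_coeff x i = 0}"

definition torus_L2_ell2 :: "'i set \<Rightarrow> ('i :: countable) ell2 torus_L2 set" where
  "torus_L2_ell2 I = {abs_torus_L2 f | f. square_integrable_torus f \<and> (\<forall>z. f z \<in> ell2_on I)}"

section \<open>Operators and subspaces\<close>

definition closed_csubspace :: "('a :: complex_inner) set \<Rightarrow> bool" where
  "closed_csubspace N \<longleftrightarrow> closed N \<and> 0 \<in> N \<and> (\<forall>x\<in>N. \<forall>y\<in>N. x + y \<in> N) \<and>
     (\<forall>c. \<forall>x\<in>N. c *\<^sub>C x \<in> N)"

definition bounded_clinear_on ::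
    "('a :: complex_inner) set \<Rightarrow> ('b :: complex_inner) set \<Rightarrow> ('a \<Rightarrow> 'b) \<Rightarrow> bool" where
  "bounded_clinear_on H K A \<longleftrightarrow> A \<in> H \<rightarrow> K \<and>
     (\<forall>x\<in>H. \<forall>y\<in>H. A (x + y) = A x + A y) \<and>
     (\<forall>c. \<forall>x\<in>H. A (c *\<^sub>C x) = c *\<^sub>C A x) \<and>
     (\<exists>B. \<forall>x\<in>H. norm (A x) \<le> B * norm x)"

definition invertible_operator_on :: "('a :: complex_inner) set \<Rightarrow> ('a \<Rightarrow> 'a) \<Rightarrow> bool" where
  "invertible_operator_on H A \<longleftrightarrow> bounded_clinear_on H H A \<and>
     (\<exists>B. bounded_clinear_on H H B \<and> (\<forall>x\<in>H. B (A x) = x \<and> A (B x) = x))"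

definition operator_powi_on :: "'a set \<Rightarrow> ('a \<Rightarrow> 'a) \<Rightarrow> int \<Rightarrow> 'a \<Rightarrow> 'a" where
  "operator_powi_on H A k = (if 0 \<le> k then A ^^ nat k else inv_into H A ^^ nat (- k))"

definition cadjoint :: "('a \<Rightarrow> 'a) \<Rightarrow> 'a \<Rightarrow> ('a :: chilbert_space)" where
  "cadjoint A = (THE B. \<forall>x y. cinner (A x) y = cinner x (B y))"

lemma cadjoint_eqI:
  assumes "\<And>x y. cinner (A x) y = cinner x (B y)"
  shows "cadjoint A = B"
  unfolding cadjoint_def
proof (rule the_equality)
  fix B' assume B': "\<forall>x y. cinner (A x) y = cinner x (B' y)"
  have "B' y = B y" for y
  proof -
    have "inner (B' y - B y) (B' y) = inner (B' y - B y) (B y)"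
      unfolding inner_eq_Re_cinner using assms B' by simp
    then have "inner (B' y - B y) (B' y - B y) = 0"
      by (simp add: inner_diff_right)
    then show ?thesis
      by simp
  qed
  then show "B' = B"
    by blast
qed (use assms in blast)

definition reducing :: "('a \<Rightarrow> 'a) \<Rightarrow> ('a :: chilbert_space) set \<Rightarrow> bool" where
  "reducing A N \<longleftrightarrow> (\<forall>x\<in>N. A x \<in> N) \<and> (\<forall>x\<in>N. cadjoint A x \<in> N)"

definition orthogonal_projection :: "('a :: chilbert_space) set \<Rightarrow> 'a \<Rightarrow> 'a" where
  "orthogonal_projection N x = (THE p. p \<in> N \<and> (\<forall>y\<in>N. cinner (x - p) y = 0))"

lemma orthogonal_projection_eqI:
  assumes "closed_csubspace N" "p \<in> N" "\<And>y. y \<in> N \<Longrightarrow> cinner (x - p) y = 0"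
  shows "orthogonal_projection N x = p"
  unfolding orthogonal_projection_def
proof (rule the_equality)
  fix q assume q: "q \<in> N \<and> (\<forall>y\<in>N. cinner (x - q) y = 0)"
  have "(- 1) *\<^sub>C p \<in> N"
    using assms by (simp only: closed_csubspace_def)
  then have "q + (- 1) *\<^sub>C p \<in> N"
    using assms q unfolding closed_csubspace_def by blast
  then have "q - p \<in> N"
    by (simp add: scaleC_minus1)
  then have "cinner (x - p) (q - p) = 0" "cinner (x - q) (q - p) = 0"
    using assms q by blast+
  then have "cinner ((x - p) - (x - q)) (q - p) = 0"
    by (simp only: cinner_diff_left[of "x - p"] diff_self)
  then have "cinner (q - p) (q - p) = 0"
    by simp
  then show "q = p"
    by (simp add: cinner_self)
qed (use assms in blast)

definition is_frame_of :: "('a :: chilbert_space) set \<Rightarrow> 'k set \<Rightarrow> ('k \<Rightarrow> 'a) \<Rightarrow> bool" where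
  "is_frame_of H K v \<longleftrightarrow> v \<in> K \<rightarrow> H \<and>
     (\<exists>A>0. \<exists>B>0. \<forall>x\<in>H. (\<lambda>k. (cmod (cinner x (v k)))\<^sup>2) summable_on K \<and>
        A * (norm x)\<^sup>2 \<le> (\<Sum>\<^sub>\<infinity>k\<in>K. (cmod (cinner x (v k)))\<^sup>2) \<and>
        (\<Sum>\<^sub>\<infinity>k\<in>K. (cmod (cinner x (v k)))\<^sup>2) \<le> B * (norm x)\<^sup>2)"

section \<open>Bilateral tuples\<close>

text \<open>
  A tuple consists of a Hilbert space (a closed subspace of its type, possibly the whole type), two
  operators on it and a family of vectors. The index set \<open>I\<close> is an arbitrary set over a countable
  type, hence at most countable and possibly empty.
\<close>

type_synonym ('a, 'i) operator_tuple = "'a set \<times> ('a \<Rightarrow> 'a) \<times> ('a \<Rightarrow> 'a) \<times> ('i \<Rightarrow> 'a)"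

fun bilateral_tuple ::
    "('i :: countable) set \<Rightarrow> ('a :: chilbert_space, 'i) operator_tuple \<Rightarrow> bool" where
  "bilateral_tuple I (H, T, L, w) \<longleftrightarrow> closed_csubspace H \<and>
     invertible_operator_on H T \<and> invertible_operator_on H L \<and>
     (\<forall>x\<in>H. T (L x) = L (T x)) \<and> w \<in> I \<rightarrow> H"

text \<open>
  The frame is the family indexed by all triples \<open>(k, j, i)\<close>, counted with multiplicity, and not
  merely its set of values.
\<close>

fun bilateral_frame_tuple ::
    "('i :: countable) set \<Rightarrow> ('a :: chilbert_space, 'i) operator_tuple \<Rightarrow> bool" where
  "bilateral_frame_tuple I (H, T, L, w) \<longleftrightarrow> bilateral_tuple I (H, T, L, w) \<and>
     is_frame_of H (UNIV \<times> UNIV \<times> I)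
       (\<lambda>(k, j, i). operator_powi_on H T k (operator_powi_on H L j (w i)))"

fun similar_tuples ::
    "('i :: countable) set \<Rightarrow> ('a :: chilbert_space, 'i) operator_tuple \<Rightarrow>
     ('b :: chilbert_space, 'i) operator_tuple \<Rightarrow> bool" where
  "similar_tuples I (H\<^sub>1, T\<^sub>1, L\<^sub>1, v) (H\<^sub>2, T\<^sub>2, L\<^sub>2, w) \<longleftrightarrow>
     (\<exists>C. bounded_clinear_on H\<^sub>1 H\<^sub>2 C \<and> bij_betw C H\<^sub>1 H\<^sub>2 \<and> (\<forall>i\<in>I. C (v i) = w i) \<and>
        (\<forall>x\<in>H\<^sub>1. T\<^sub>2 (C x) = C (T\<^sub>1 x)) \<and> (\<forall>x\<in>H\<^sub>1. L\<^sub>2 (C x) = C (L\<^sub>1 x)))"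

text \<open>
  Restrictions are extensional (\<open>undefined\<close> outside the subspace, respectively outside the index
  set), so that equality of basic tuples is equality of all four components. Since the subspace lies
  in \<^term>\<open>torus_L2_ell2 I\<close>, which reduces both multiplication operators, adjoints and projections may
  be taken in the ambient type.
\<close>

definition bilateral_basic_tuple ::
    "('i :: countable) set \<Rightarrow> ('i ell2 torus_L2, 'i) operator_tuple \<Rightarrow> bool" where
  "bilateral_basic_tuple I B \<longleftrightarrow>
     (\<exists>N. closed_csubspace N \<and> N \<subseteq> torus_L2_ell2 I \<and> reducing torus_U1 N \<and> reducing torus_U2 N \<and>
        B = (N, restrict torus_U1 N, restrict torus_U2 N,
             restrict (\<lambda>i. orthogonal_projection N (torus_const (ell2_unit i))) I))"

end

theory Submission
  imports Defs
begin

text \<open>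
  The frame in question is a \<open>\<int>\<^sup>2\<close>-orbit indexed by \<open>(k, j, i)\<close>, and so is the orthonormal basis
  \<open>z\<^sub>1\<^sup>k z\<^sub>2\<^sup>j \<epsilon>\<^sub>i\<close> of \<open>L\<^sup>2(\<T>\<^sup>2, \<ell>\<^sup>2(I))\<close>, on which multiplication by \<open>z\<^sub>1\<close> and \<open>z\<^sub>2\<close> acts by shifting \<open>k\<close> and
  \<open>j\<close>. The link between the two is the analysis operator \<open>\<Theta>\<close> of the orbit, which maps \<open>x\<close> to the
  function with coordinates \<open>\<langle>x, T\<^sup>k L\<^sup>j w\<^sub>i\<rangle>\<close>. By Parseval's identity the frame inequalities say exactly
  that \<open>\<Theta>\<close> is bounded and bounded below.

  If the orbit is a frame, the range \<open>N\<close> of \<open>\<Theta>\<close> is closed. It is reducing, because \<open>\<Theta>\<close> intertwines the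
  adjoints of \<open>T\<close>, \<open>L\<close> and of their inverses with the backward and forward shifts. The adjoint of the
  inverse of \<open>\<Theta>\<close> is then a similarity onto the basic tuple carried by \<open>N\<close> (lemma \<open>frame_basic_model\<close>).

  Conversely let \<open>C\<close> be a similarity onto the basic tuple carried by \<open>N\<close>. It maps \<open>T\<^sup>k L\<^sup>j w\<^sub>i\<close> to the
  projection of \<open>z\<^sub>1\<^sup>k z\<^sub>2\<^sup>j \<epsilon>\<^sub>i\<close> onto \<open>N\<close>, and therefore the adjoint of \<open>C\<^sup>-\<^sup>1\<close> is the analysis operator
  (lemma \<open>basic_model_analysis\<close>). It is bounded and bounded below, so the orbit is a frame. Its range is
  \<open>N\<close>; since the analysis operator depends on the orbit only, \<open>N\<close> and with it the basic tuple is unique.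

  This part is carried out for any Hilbert space with two unitary shifts of an orthonormal basis. It
  rests on the Riesz representation theorem, which supplies adjoints, projections and the
  Riesz-Fischer theorem, and on the bounded inverse theorem, which is needed because a similarity is
  only assumed to be a bounded bijection. What remains specific to the torus is that the trigonometric
  functions form an orthonormal basis; totality comes from the Stone-Weierstrass theorem
  (lemma \<open>fourier_null_AE_zero\<close>).
\<close>

section \<open>Riesz representation\<close>

lemma cinner_zero_left [simp]: "cinner 0 (y :: 'a :: complex_inner) = 0"
  using cinner_add_left[of 0 0 y] by simp

lemma cinner_zero_right [simp]: "cinner (x :: 'a :: complex_inner) 0 = 0"
  using cinner_add_right[of x 0 0] by simp

lemma cinner_minus_right: "cinner x (- y) = - cinner x (y :: 'a :: complex_inner)"
  by (metis cinner_commute cinner_minus_left complex_cnj_minus)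

lemma cinner_diff_right: "cinner x (y - z) = cinner x y - cinner x (z :: 'a :: complex_inner)"
  by (metis cinner_add_right cinner_minus_right diff_conv_add_uminus)

lemma cinner_sum_left: "cinner (\<Sum>k\<in>F. f k) (y :: 'a :: complex_inner) = (\<Sum>k\<in>F. cinner (f k) y)"
  by (induction F rule: infinite_finite_induct) (simp_all add: cinner_add_left)

lemma cinner_sum_right: "cinner y (\<Sum>k\<in>F. f k) = (\<Sum>k\<in>F. cinner y (f k :: 'a :: complex_inner))"
  by (induction F rule: infinite_finite_induct) (simp_all add: cinner_add_right)

lemma cinner_eq_zero_iff: "cinner x x = 0 \<longleftrightarrow> (x :: 'a :: complex_inner) = 0"
  by (simp add: cinner_self)

lemma cinner_ext:
  assumes "\<And>z :: 'a :: complex_inner. cinner z x = cinner z y"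
  shows "x = y"
  using assms[of "x - y"] by (metis cinner_diff_right cinner_eq_zero_iff diff_self eq_iff_diff_eq_0)

lemma bounded_clinear_on_D:
  assumes "bounded_clinear_on H K A"
  shows "x \<in> H \<Longrightarrow> A x \<in> K"
    and "x \<in> H \<Longrightarrow> y \<in> H \<Longrightarrow> A (x + y) = A x + A y"
    and "x \<in> H \<Longrightarrow> A (c *\<^sub>C x) = c *\<^sub>C A x"
  using assms by (auto simp: bounded_clinear_on_def)

lemma bounded_clinear_on_bound:
  assumes "bounded_clinear_on H K A"
  obtains B where "B > 0" "\<And>x. x \<in> H \<Longrightarrow> norm (A x) \<le> B * norm x"
proof -
  obtain B where B: "\<forall>x\<in>H. norm (A x) \<le> B * norm x"
    using assms by (auto simp: bounded_clinear_on_def)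
  have "norm (A x) \<le> (\<bar>B\<bar> + 1) * norm x" if "x \<in> H" for x
    using B that by (smt (verit) mult_right_mono norm_ge_zero)
  then show ?thesis
    by (intro that[of "\<bar>B\<bar> + 1"]) auto
qed

lemma closed_csubspace_UNIV: "closed_csubspace UNIV"
  by (simp add: closed_csubspace_def)

lemma closed_csubspace_scaleR: "closed_csubspace N \<Longrightarrow> x \<in> N \<Longrightarrow> r *\<^sub>R x \<in> N"
  by (metis closed_csubspace_def scaleC_of_real)

lemma closed_csubspace_diff: "closed_csubspace N \<Longrightarrow> x \<in> N \<Longrightarrow> y \<in> N \<Longrightarrow> x - y \<in> N"
  by (metis closed_csubspace_def scaleC_minus1 diff_conv_add_uminus)

lemma cinner_ext_on:
  assumes "closed_csubspace N" "x \<in> N" "y \<in> N" "\<And>z. z \<in> N \<Longrightarrow> cinner z x = cinner z y"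
  shows "x = y"
  using assms(4)[OF closed_csubspace_diff[OF assms(1-3)]]
  by (metis cinner_diff_right cinner_eq_zero_iff diff_self eq_iff_diff_eq_0)

lemma nonneg_quadratic_linear_term_zero:
  fixes p q :: real
  assumes "p \<ge> 0" "\<And>t. 0 \<le> t\<^sup>2 * p + 2 * t * q"
  shows "q = 0"
proof -
  define u where "u = q / (p + 1)"
  have q: "q = u * (p + 1)"
    using assms(1) by (simp add: u_def)
  have "(- u)\<^sup>2 * p + 2 * (- u) * q = - (u\<^sup>2 * (p + 2))"
    by (simp add: q power2_eq_square algebra_simps)
  then have "u\<^sup>2 * (p + 2) \<le> 0"
    using assms(2)[of "- u"] by linarith
  then have "u = 0"
    using assms(1) by (simp add: mult_le_0_iff)
  then show ?thesis
    by (simp add: q)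
qed

text \<open>
  The representing vector is the minimiser of \<open>\<parallel>f\<parallel>\<^sup>2 - 2 Re (\<phi> f)\<close> over \<open>N\<close>: by the parallelogram law
  minimising sequences are Cauchy, and at a minimum the first variation vanishes.
\<close>

lemma riesz_representation:
  fixes \<phi> :: "'a :: chilbert_space \<Rightarrow> complex"
  assumes N: "closed_csubspace N"
    and add: "\<And>f g. f \<in> N \<Longrightarrow> g \<in> N \<Longrightarrow> \<phi> (f + g) = \<phi> f + \<phi> g"
    and scale: "\<And>c f. f \<in> N \<Longrightarrow> \<phi> (c *\<^sub>C f) = c * \<phi> f"
    and bound: "\<And>f. f \<in> N \<Longrightarrow> cmod (\<phi> f) \<le> B * norm f"
  obtains y where "y \<in> N" "\<And>f. f \<in> N \<Longrightarrow> \<phi> f = cinner f y"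
proof -
  define J where "J f = (norm f)\<^sup>2 - 2 * Re (\<phi> f)" for f
  have N0: "0 \<in> N" and Nadd: "\<And>f g. f \<in> N \<Longrightarrow> g \<in> N \<Longrightarrow> f + g \<in> N"
    and Nscale: "\<And>c f. f \<in> N \<Longrightarrow> c *\<^sub>C f \<in> N" and Nclosed: "closed N"
    using N by (auto simp: closed_csubspace_def)
  have scaleR: "Re (\<phi> (r *\<^sub>R f)) = r * Re (\<phi> f)" if "f \<in> N" for r f
    using scale[OF that, of "complex_of_real r"] by (simp add: scaleC_of_real)
  have diff: "\<phi> (f - g) = \<phi> f - \<phi> g" if "f \<in> N" "g \<in> N" for f g
    using add[OF closed_csubspace_diff[OF N that] that(2)] by simp
  have J_ge: "- B\<^sup>2 \<le> J f" if "f \<in> N" for f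
  proof -
    have "Re (\<phi> f) \<le> B * norm f"
      using bound[OF that] complex_Re_le_cmod order_trans by blast
    then show ?thesis
      using zero_le_power2[of "norm f - B"] by (simp add: J_def power2_eq_square algebra_simps)
  qed
  define m where "m = Inf (J ` N)"
  have m_le: "m \<le> J f" if "f \<in> N" for f
    unfolding m_def by (rule cInf_lower) (use J_ge that in \<open>auto intro!: bdd_belowI2[where m = "- B\<^sup>2"]\<close>)
  have "\<exists>f\<in>N. J f < m + inverse (real (Suc n))" for n
    using cInf_lessD[of "J ` N" "m + inverse (real (Suc n))"] N0
    unfolding m_def by (metis (no_types, lifting) empty_iff image_iff inverse_positive_iff_positive
        less_add_same_cancel1 of_nat_0_less_iff zero_less_Suc)
  then obtain y where y: "\<And>n. y n \<in> N" "\<And>n. J (y n) < m + inverse (real (Suc n))"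
    by metis
  have parallelogram: "(norm (f - g))\<^sup>2 \<le> 2 * (J f - m) + 2 * (J g - m)"
    if "f \<in> N" "g \<in> N" for f g
  proof -
    define h where "h = (1/2) *\<^sub>R (f + g)"
    have "h \<in> N"
      unfolding h_def using that N by (intro closed_csubspace_scaleR Nadd)
    have "J f + J g - 2 * J h = (norm (f - g))\<^sup>2 / 2"
      unfolding J_def h_def scaleR[OF Nadd[OF that]] add[OF that]
      by (simp add: power2_norm_eq_inner inner_simps inner_commute field_simps)
    then show ?thesis
      using m_le[OF \<open>h \<in> N\<close>] by argo
  qed
  have "Cauchy y"
  proof (rule metric_CauchyI)
    fix r :: real assume r: "r > 0"
    obtain n0 where n0: "inverse (real (Suc n0)) < r\<^sup>2 / 4"
      using reals_Archimedean[of "r\<^sup>2 / 4"] r by auto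
    have J0: "J (y n) - m < r\<^sup>2 / 4" if "n \<ge> n0" for n
    proof -
      have "inverse (real (Suc n)) \<le> inverse (real (Suc n0))"
        using that by (simp add: field_simps)
      then show ?thesis
        using y(2)[of n] n0 by linarith
    qed
    have "dist (y k) (y n) < r" if "k \<ge> n0" "n \<ge> n0" for k n
    proof -
      have "(norm (y k - y n))\<^sup>2 < r\<^sup>2"
        using parallelogram[OF y(1) y(1), of k n] J0[OF that(1)] J0[OF that(2)] by argo
      then show ?thesis
        using r by (simp add: dist_norm power2_less_imp_less)
    qed
    then show "\<exists>M. \<forall>k\<ge>M. \<forall>n\<ge>M. dist (y k) (y n) < r"
      by blast
  qed
  then obtain l where l: "y \<longlonglongrightarrow> l"
    using Cauchy_convergent convergent_def by blast
  have lN: "l \<in> N"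
    using Nclosed l y(1) closed_sequentially by blast
  have "(\<lambda>n. \<phi> (y n) - \<phi> l) \<longlonglongrightarrow> 0"
  proof (rule Lim_null_comparison)
    show "\<forall>\<^sub>F n in sequentially. norm (\<phi> (y n) - \<phi> l) \<le> B * norm (y n - l)"
      using bound[OF closed_csubspace_diff[OF N y(1) lN]] diff[OF y(1) lN] by simp
    have "(\<lambda>n. norm (y n - l)) \<longlonglongrightarrow> 0"
      using l by (simp add: LIM_zero tendsto_norm_zero)
    then show "(\<lambda>n. B * norm (y n - l)) \<longlonglongrightarrow> 0"
      using tendsto_mult_right_zero by blast
  qed
  then have "(\<lambda>n. \<phi> (y n)) \<longlonglongrightarrow> \<phi> l"
    by (rule LIM_zero_cancel)
  then have "(\<lambda>n. J (y n)) \<longlonglongrightarrow> J l"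
    unfolding J_def by (intro tendsto_intros l)
  moreover have "(\<lambda>n. m + inverse (real (Suc n))) \<longlonglongrightarrow> m"
    using tendsto_add[OF tendsto_const LIMSEQ_inverse_real_of_nat, of m] by simp
  ultimately have Jl: "J l \<le> m"
    by (rule LIMSEQ_le) (use y(2) less_imp_le in blast)
  have Re_eq: "Re (\<phi> f) = Re (cinner f l)" if f: "f \<in> N" for f
  proof -
    have "0 \<le> t\<^sup>2 * (norm f)\<^sup>2 + 2 * t * (inner f l - Re (\<phi> f))" for t
    proof -
      have tf: "t *\<^sub>R f \<in> N"
        using f N by (intro closed_csubspace_scaleR)
      \<comment> \<open>\<open>l\<close> minimises \<open>J\<close>, so this quadratic polynomial in \<open>t\<close> is nonnegative and its linear term vanishes\<close>
      have "J (l + t *\<^sub>R f) - J l = t\<^sup>2 * (norm f)\<^sup>2 + 2 * t * (inner f l - Re (\<phi> f))"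
        unfolding J_def add[OF lN tf] power2_norm_eq_inner
        by (simp add: scaleR[OF f] inner_simps inner_commute power2_eq_square algebra_simps)
      then show ?thesis
        using m_le[OF Nadd[OF lN tf]] Jl by linarith
    qed
    then have "inner f l - Re (\<phi> f) = 0"
      by (rule nonneg_quadratic_linear_term_zero[rotated]) simp
    then show ?thesis
      by (simp add: inner_eq_Re_cinner)
  qed
  have "\<phi> f = cinner f l" if "f \<in> N" for f
    using Re_eq[OF that] Re_eq[OF Nscale[OF that, of \<i>]] scale[OF that, of \<i>]
    by (simp add: complex_eq_iff cinner_scaleC_left)
  then show ?thesis
    using that lN by blast
qed

lemma
  assumes N: "closed_csubspace N"
  shows orthogonal_projection_mem: "orthogonal_projection N x \<in> N"
    and cinner_orthogonal_projection: "y \<in> N \<Longrightarrow> cinner y (orthogonal_projection N x) = cinner y x"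
proof -
  obtain p where p: "p \<in> N" "\<And>f. f \<in> N \<Longrightarrow> cinner f x = cinner f p"
    by (rule riesz_representation[OF N, of "\<lambda>f. cinner f x" "norm x"])
      (auto simp: cinner_add_left cinner_scaleC_left mult.commute intro: norm_cinner_le order_trans)
  have "cinner (x - p) y = 0" if "y \<in> N" for y
    using p(2)[OF that] by (metis cinner_commute cinner_diff_right complex_cnj_zero diff_self)
  then have "orthogonal_projection N x = p"
    using N p(1) by (intro orthogonal_projection_eqI) auto
  then show "orthogonal_projection N x \<in> N"
    and "y \<in> N \<Longrightarrow> cinner y (orthogonal_projection N x) = cinner y x"
    using p by auto
qed

text \<open>
  The Riesz representation of the functionals \<open>y \<mapsto> \<langle>C y, x\<rangle>\<close>. The domain may be a proper closed subspace,
  because below this is applied to inverses that are defined only on the carrier of a basic tuple.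
\<close>

lemma adjoint_exists:
  fixes C :: "'a :: chilbert_space \<Rightarrow> 'b :: complex_inner"
  assumes N: "closed_csubspace N" and C: "bounded_clinear_on N K C"
  obtains D where "\<And>x. D x \<in> N" "\<And>x y. y \<in> N \<Longrightarrow> cinner (C y) x = cinner y (D x)"
proof -
  obtain B where B: "B > 0" "\<And>x. x \<in> N \<Longrightarrow> norm (C x) \<le> B * norm x"
    using bounded_clinear_on_bound[OF C] by metis
  have "\<exists>d\<in>N. \<forall>y\<in>N. cinner (C y) x = cinner y d" for x
  proof -
    have "cmod (cinner (C f) x) \<le> B * norm x * norm f" if "f \<in> N" for f
      using norm_cinner_le[of "C f" x] mult_right_mono[OF B(2)[OF that], of "norm x"]
      by (simp add: mult_ac)
    then obtain d where "d \<in> N" "\<And>f. f \<in> N \<Longrightarrow> cinner (C f) x = cinner f d"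
      by (rule riesz_representation[OF N, of "\<lambda>f. cinner (C f) x", rotated 2])
        (auto simp: bounded_clinear_on_D[OF C] cinner_add_left cinner_scaleC_left)
    then show ?thesis
      by blast
  qed
  then show ?thesis
    using that by metis
qed

section \<open>The bounded inverse theorem\<close>

text \<open>
  By the Baire category theorem the closure of the image of some ball has interior relative to the
  range. Hence every \<open>y\<close> in the range is approximated up to \<open>\<parallel>y\<parallel> / 2\<close> by an image of a vector of norm
  at most \<open>K \<parallel>y\<parallel>\<close>; repeating this with the remainder gives a convergent series that maps to \<open>y\<close>.
\<close>

lemma inj_bounded_linear_bounded_below:
  fixes C :: "'a :: banach \<Rightarrow> 'b :: banach"
  assumes C: "bounded_linear C" and inj: "inj C" and closed: "closed (range C)"
  obtains c where "c > 0" "\<And>x. norm x \<le> c * norm (C x)"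
proof -
  interpret C: bounded_linear C by (rule C)
  define R where "R = range C"
  have R: "subspace R"
    unfolding R_def by (rule linear_subspace_image[OF C.linear subspace_UNIV])
  define A where "A n = closure (C ` cball 0 (real n))" for n
  have A_R: "A n \<subseteq> R" for n
    unfolding A_def R_def using closed by (intro closure_minimal) auto
  have A_closedin: "closedin (top_of_set R) (A n)" for n
    by (intro closed_subset A_R) (simp add: A_def)
  have cover: "\<Union> (range A) = R"
  proof
    show "R \<subseteq> \<Union> (range A)"
    proof
      fix y assume "y \<in> R"
      then obtain x where x: "y = C x"
        by (auto simp: R_def)
      obtain n where "norm x \<le> real n"
        using real_arch_simple by blast
      then have "y \<in> A n"
        unfolding A_def x by (intro closure_subset[THEN subsetD] imageI) auto
      then show "y \<in> \<Union> (range A)" by blast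
    qed
  qed (use A_R in blast)
  have "\<exists>n. top_of_set R interior_of A n \<noteq> {}"
  proof (rule ccontr)
    assume "\<not> ?thesis"
    then have "top_of_set R interior_of \<Union> (range A) = {}"
      using closed A_closedin \<open>\<not> _\<close>
      by (intro Baire_category_alt disjI1 completely_metrizable_space_closedin
          completely_metrizable_space_euclidean)
        (auto simp: R_def)
    then show False
      unfolding cover using interior_of_topspace[of "top_of_set R"] by (simp add: R_def)
  qed
  then obtain n a where a: "a \<in> top_of_set R interior_of A n"
    by blast
  then obtain S where S: "openin (top_of_set R) S" "a \<in> S" "S \<subseteq> A n"
    unfolding interior_of_def by blast
  then obtain r where r: "r > 0" "ball a r \<inter> R \<subseteq> A n" and aR: "a \<in> R"
    unfolding openin_contains_ball by (metis (no_types, lifting) S(2) subset_trans subsetD)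
  define M where "M = real n"
  have near: "\<exists>u. norm u \<le> M \<and> norm (C u - z) < \<epsilon>" if "z \<in> ball a r \<inter> R" "\<epsilon> > 0" for z \<epsilon>
  proof -
    have "z \<in> closure (C ` cball 0 M)"
      using r(2) that unfolding A_def M_def by blast
    then show ?thesis
      using that(2) unfolding closure_approachable by (metis (no_types, lifting) image_iff dist_norm mem_cball_0)
  qed
  \<comment> \<open>symmetrising about the centre \<open>a\<close> moves the approximation to a neighbourhood of \<open>0\<close>\<close>
  have small: "\<exists>u. norm u \<le> M \<and> norm (C u - y) \<le> \<epsilon>"
    if y: "y \<in> R" "norm y < r" and \<epsilon>: "\<epsilon> > 0" for y \<epsilon>
  proof -
    have "a + y \<in> R" "a - y \<in> R"
      using aR y(1) by (simp_all add: R subspace_add subspace_diff)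
    then have "a + y \<in> ball a r \<inter> R" "a - y \<in> ball a r \<inter> R"
      using y(2) by (simp_all add: dist_norm)
    then obtain u v where u: "norm u \<le> M" "norm (C u - (a + y)) < \<epsilon>"
      and v: "norm v \<le> M" "norm (C v - (a - y)) < \<epsilon>"
      using near \<epsilon> by metis
    define w where "w = (1/2) *\<^sub>R (u - v)"
    have "norm w \<le> M"
      using u(1) v(1) norm_triangle_ineq4[of u v] by (simp add: w_def)
    moreover have "C w - y = (1/2) *\<^sub>R ((C u - (a + y)) - (C v - (a - y)))"
      by (simp add: w_def C.scaleR C.diff algebra_simps flip: scaleR_add_left)
    then have "norm (C w - y) \<le> \<epsilon>"
      using u(2) v(2) norm_triangle_ineq4[of "C u - (a + y)" "C v - (a - y)"] by simp
    ultimately show ?thesis by blast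
  qed
  define K where "K = 2 * M / r"
  have "\<exists>w. norm w \<le> K * norm y \<and> norm (y - C w) \<le> norm y / 2" if y: "y \<in> R" for y
  proof (cases "y = 0")
    case False
    define s where "s = r / (2 * norm y)"
    have s: "s > 0" "s * norm y = r / 2"
      using False r by (auto simp: s_def)
    have half: "1 / s * (r / 4) = norm y / 2"
      using r by (simp add: s_def)
    have "s *\<^sub>R y \<in> R"
      using y by (simp add: R subspace_scale)
    then obtain u where u: "norm u \<le> M" "norm (C u - s *\<^sub>R y) \<le> r / 4"
      using small[of "s *\<^sub>R y" "r / 4"] s r by auto
    have "norm ((1/s) *\<^sub>R u) \<le> K * norm y"
      using u(1) s(1) r False by (simp add: K_def s_def field_simps)
    moreover have "y - C ((1/s) *\<^sub>R u) = - ((1/s) *\<^sub>R (C u - s *\<^sub>R y))"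
      using s by (simp add: C.scaleR scaleR_diff_right)
    then have "norm (y - C ((1/s) *\<^sub>R u)) = (1/s) * norm (C u - s *\<^sub>R y)"
      using s by simp
    then have "norm (y - C ((1/s) *\<^sub>R u)) \<le> norm y / 2"
      using mult_left_mono[OF u(2), of "1/s"] s(1) half by simp
    ultimately show ?thesis by blast
  qed (auto intro!: exI[of _ 0])
  then obtain W where W: "\<And>y. y \<in> R \<Longrightarrow> norm (W y) \<le> K * norm y"
    "\<And>y. y \<in> R \<Longrightarrow> norm (y - C (W y)) \<le> norm y / 2"
    by metis
  have K: "K \<ge> 0"
    using r by (simp add: K_def M_def)
  have "norm x \<le> (2 * K + 1) * norm (C x)" for x
  proof -
    define y where "y = C x"
    \<comment> \<open>the remainder of \<open>y\<close> after \<open>k\<close> approximation steps; each step at least halves its norm\<close>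
    define \<rho> where "\<rho> k = ((\<lambda>z. z - C (W z)) ^^ k) y" for k
    have \<rho>_Suc: "\<rho> (Suc k) = \<rho> k - C (W (\<rho> k))" for k
      by (simp add: \<rho>_def)
    have \<rho>_R: "\<rho> k \<in> R" for k
    proof (induction k)
      case (Suc k)
      then show ?case
        unfolding \<rho>_Suc by (intro subspace_diff[OF R]) (auto simp: R_def)
    qed (simp add: \<rho>_def y_def R_def)
    have \<rho>_norm: "norm (\<rho> k) \<le> norm y * (1/2) ^ k" for k
    proof (induction k)
      case (Suc k)
      then show ?case
        using W(2)[OF \<rho>_R[of k]] by (simp add: \<rho>_Suc)
    qed (simp add: \<rho>_def)
    define u where "u k = W (\<rho> k)" for k
    have u_norm: "norm (u k) \<le> K * norm y * (1/2) ^ k" for k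
      using W(1)[OF \<rho>_R[of k]] mult_left_mono[OF \<rho>_norm K, of k] by (simp add: u_def mult.assoc)
    have geom: "(\<lambda>k. K * norm y * (1/2) ^ k) sums (K * norm y * 2)"
      using sums_mult[OF geometric_sums[of "1/2 :: real"], of "K * norm y"] by simp
    have u: "summable (\<lambda>k. norm (u k))"
      by (rule summable_comparison_test'[OF sums_summable[OF geom], of 0]) (use u_norm in auto)
    have "(\<Sum>k<n. C (u k)) = y - \<rho> n" for n
      by (induction n) (auto simp: \<rho>_Suc u_def, simp add: \<rho>_def)
    moreover have "\<rho> \<longlonglongrightarrow> 0"
      by (rule Lim_null_comparison[OF always_eventually tendsto_mult_right_zero[OF LIMSEQ_power_zero[of "1/2 :: real"]]])
        (use \<rho>_norm in auto)
    ultimately have "(\<lambda>k. C (u k)) sums y"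
      unfolding sums_def using tendsto_diff[OF tendsto_const, of \<rho> 0 sequentially y] by simp
    moreover have "(\<lambda>k. C (u k)) sums C (suminf u)"
      using summable_norm_cancel[OF u] by (intro C.sums summable_sums)
    ultimately have "suminf u = x"
      using inj sums_unique2 unfolding y_def by (metis injD)
    moreover have "norm (suminf u) \<le> (\<Sum>k. norm (u k))"
      by (rule summable_norm[OF u])
    moreover have "(\<Sum>k. norm (u k)) \<le> K * norm y * 2"
      using suminf_le[OF u_norm u sums_summable[OF geom]] sums_unique[OF geom] by simp
    ultimately have "norm x \<le> 2 * K * norm y"
      by simp
    also have "\<dots> \<le> (2 * K + 1) * norm y"
      by (simp add: distrib_right)
    finally show ?thesis
      by (simp add: y_def)
  qed
  then show ?thesis
    using K by (intro that[of "2 * K + 1"]) auto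
qed

section \<open>Orthonormal bases\<close>

locale orthonormal_basis =
  fixes e :: "'k \<Rightarrow> 'b :: chilbert_space"
  assumes orthonormal: "cinner (e k) (e l) = (if k = l then 1 else 0)"
    and total: "(\<And>k. cinner x (e k) = 0) \<Longrightarrow> x = 0"
begin

lemma eqI: "(\<And>k. cinner x (e k) = cinner y (e k)) \<Longrightarrow> x = y"
  using total[of "x - y"] by (simp add: cinner_diff_left)

lemma bessel_finite:
  assumes "finite F"
  shows "(\<Sum>k\<in>F. (cmod (cinner x (e k)))\<^sup>2) \<le> (norm x)\<^sup>2"
proof -
  define p where "p = (\<Sum>k\<in>F. cinner x (e k) *\<^sub>C e k)"
  define s where "s = (\<Sum>k\<in>F. (cmod (cinner x (e k)))\<^sup>2)"
  have xp: "cinner x p = complex_of_real s"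
    by (simp add: p_def s_def cinner_sum_right cinner_scaleC_right complex_norm_square mult.commute
        del: of_real_power)
  have ep: "cinner p (e k) = cinner x (e k)" if "k \<in> F" for k
    using assms that by (simp add: p_def cinner_sum_left cinner_scaleC_left orthonormal if_distrib cong: if_cong)
  have "cinner p p = (\<Sum>k\<in>F. cnj (cinner x (e k)) * cinner p (e k))"
    by (subst (2) p_def) (simp add: cinner_sum_right cinner_scaleC_right)
  also have "\<dots> = complex_of_real s"
    using ep by (simp add: s_def of_real_sum complex_norm_square mult.commute del: of_real_power)
  finally have pp: "cinner p p = complex_of_real s" .
  have "cinner p x = complex_of_real s"
    using xp cinner_commute[of p x] by simp
  then have "complex_of_real ((norm (x - p))\<^sup>2) = complex_of_real ((norm x)\<^sup>2 - s)"
    unfolding cinner_self[symmetric] of_real_diff using xp pp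
    by (simp add: cinner_diff_left cinner_diff_right)
  then have "(norm (x - p))\<^sup>2 = (norm x)\<^sup>2 - s"
    by (simp only: of_real_eq_iff)
  then show ?thesis
    using zero_le_power2[of "norm (x - p)"] by (simp add: s_def)
qed

lemma coefficients_summable: "(\<lambda>k. (cmod (cinner x (e k)))\<^sup>2) summable_on UNIV"
  by (rule nonneg_bdd_above_summable_on) (auto intro!: bdd_aboveI2[where M = "(norm x)\<^sup>2"] bessel_finite)

definition coords :: "'b \<Rightarrow> 'k ell2" where
  "coords x = Abs_ell2 (\<lambda>k. cinner x (e k))"

lemma coeff_coords: "ell2_coeff (coords x) k = cinner x (e k)"
  by (simp add: coords_def Abs_ell2_inverse coefficients_summable)

lemma coords_add: "coords (x + y) = coords x + coords y"
  by (simp add: ell2_coeff_inject[symmetric] fun_eq_iff coeff_coords plus_ell2.rep_eq cinner_add_left)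

lemma coords_scaleC: "coords (c *\<^sub>C x) = c *\<^sub>C coords x"
  by (simp add: ell2_coeff_inject[symmetric] fun_eq_iff coeff_coords scaleC_ell2.rep_eq cinner_scaleC_left)

lemma norm_coords_le: "norm (coords x) \<le> norm x"
proof -
  have "(norm (coords x))\<^sup>2 \<le> (norm x)\<^sup>2"
    unfolding norm_ell2_sq coeff_coords
    by (intro infsum_le_finite_sums coefficients_summable bessel_finite)
  then show ?thesis
    by (simp add: power2_le_iff_abs_le)
qed

lemma coords_basis: "coords (e k) = ell2_unit k"
  by (simp add: ell2_coeff_inject[symmetric] fun_eq_iff coeff_coords ell2_coeff_unit orthonormal)

text \<open>
  The vector with coordinates \<open>c\<close> is found without summing a series in the space: it represents the
  functional \<open>f \<mapsto> \<langle>coords f, c\<rangle>\<close>, which is bounded by Bessel's inequality. Parseval's identity is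
  this description of the vector with coordinates \<open>coords y\<close>.
\<close>

lemma riesz_fischer:
  obtains x where "coords x = c" "\<And>f. cinner (coords f) c = cinner f x"
proof -
  have "cmod (cinner (coords f) c) \<le> norm c * norm f" for f
    using norm_cinner_le[of "coords f" c] mult_right_mono[OF norm_coords_le norm_ge_zero, of f c]
    by (simp add: mult.commute)
  then obtain x where x: "\<And>f. cinner (coords f) c = cinner f x"
    by (rule riesz_representation[OF closed_csubspace_UNIV, of "\<lambda>f. cinner (coords f) c" "norm c", rotated 2])
      (auto simp: coords_add coords_scaleC cinner_add_left cinner_scaleC_left)
  have "cinner (ell2_unit k) c = cnj (ell2_coeff c k)" for k
  proof -
    have "cinner (ell2_unit k) c = (\<Sum>\<^sub>\<infinity>i\<in>{k}. (if i = k then 1 else 0) * cnj (ell2_coeff c i))"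
      unfolding cinner_ell2.rep_eq ell2_coeff_unit by (rule infsum_cong_neutral) auto
    then show ?thesis by simp
  qed
  then have "ell2_coeff (coords x) k = ell2_coeff c k" for k
    using x[of "e k"] unfolding coords_basis coeff_coords
    by (metis cinner_commute complex_cnj_cnj)
  then have "coords x = c"
    by (simp add: ell2_coeff_inject[symmetric] fun_eq_iff)
  then show ?thesis
    using that x by blast
qed

lemma coords_eq_iff: "coords x = coords y \<longleftrightarrow> x = y"
  using eqI[of x y] by (metis coeff_coords)

lemma parseval: "cinner (coords x) (coords y) = cinner x y"
  using riesz_fischer[of "coords y"] by (metis coords_eq_iff)

lemma norm_coords: "norm (coords x) = norm x"
proof -
  have "complex_of_real ((norm (coords x))\<^sup>2) = complex_of_real ((norm x)\<^sup>2)"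
    unfolding cinner_self[symmetric] by (rule parseval)
  then show ?thesis
    by (simp only: of_real_eq_iff) simp
qed

lemma norm_sq_eq_infsum: "(norm x)\<^sup>2 = (\<Sum>\<^sub>\<infinity>k. (cmod (cinner x (e k)))\<^sup>2)"
  using norm_ell2_sq[of "coords x"] by (simp add: norm_coords coeff_coords)

end

section \<open>Frames over a pair of bilateral shifts\<close>

text \<open>
  The model space \<open>L\<^sup>2(\<T>\<^sup>2, \<ell>\<^sup>2)\<close> enters the argument only through this structure: an orthonormal basis on
  which two unitaries act by shifting one index each. The adjoints \<open>V\<^sub>1\<close> and \<open>V\<^sub>2\<close> are parameters so that
  reducing subspaces are simply those invariant under all four operators.
\<close>

locale bilateral_shifts = orthonormal_basis e
  for e :: "int \<times> int \<times> 'i \<Rightarrow> 'b :: chilbert_space" +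
  fixes U\<^sub>1 U\<^sub>2 V\<^sub>1 V\<^sub>2 :: "'b \<Rightarrow> 'b"
  assumes adjoint1: "cinner (U\<^sub>1 x) y = cinner x (V\<^sub>1 y)"
    and adjoint2: "cinner (U\<^sub>2 x) y = cinner x (V\<^sub>2 y)"
    and inverse1: "U\<^sub>1 (V\<^sub>1 x) = x" "V\<^sub>1 (U\<^sub>1 x) = x"
    and inverse2: "U\<^sub>2 (V\<^sub>2 x) = x" "V\<^sub>2 (U\<^sub>2 x) = x"
    and shift1: "U\<^sub>1 (e (k, j, i)) = e (k + 1, j, i)"
    and shift2: "U\<^sub>2 (e (k, j, i)) = e (k, j + 1, i)"
begin

lemma shift_back1: "V\<^sub>1 (e (k, j, i)) = e (k - 1, j, i)"
  using inverse1(2)[of "e (k - 1, j, i)"] by (simp add: shift1)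

lemma shift_back2: "V\<^sub>2 (e (k, j, i)) = e (k, j - 1, i)"
  using inverse2(2)[of "e (k, j - 1, i)"] by (simp add: shift2)

lemma adjoint1': "cinner (V\<^sub>1 x) y = cinner x (U\<^sub>1 y)"
  by (metis adjoint1 cinner_commute)

lemma adjoint2': "cinner (V\<^sub>2 x) y = cinner x (U\<^sub>2 y)"
  by (metis adjoint2 cinner_commute)

lemma cadjoint_shift: "cadjoint U\<^sub>1 = V\<^sub>1" "cadjoint U\<^sub>2 = V\<^sub>2"
  by (intro cadjoint_eqI adjoint1 adjoint2)+

text \<open>
  The closed linear span of the basis vectors with index in \<open>I\<close>, described by the vanishing of the
  remaining coordinates.
\<close>

definition spanned :: "'i set \<Rightarrow> 'b set" where
  "spanned I = {x. \<forall>k j i. i \<notin> I \<longrightarrow> cinner x (e (k, j, i)) = 0}"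

end

lemma range_closed_csubspace:
  fixes \<Theta> :: "'a :: chilbert_space \<Rightarrow> 'b :: chilbert_space"
  assumes \<Theta>: "bounded_clinear_on UNIV UNIV \<Theta>"
    and below: "a > 0" "\<And>x. a * norm x \<le> norm (\<Theta> x)"
  shows "closed_csubspace (range \<Theta>)"
  unfolding closed_csubspace_def
proof (intro conjI allI ballI)
  obtain B where B: "\<And>x. norm (\<Theta> x) \<le> B * norm x"
    using bounded_clinear_on_bound[OF \<Theta>] by (metis UNIV_I)
  have lin: "bounded_linear \<Theta>"
    using bounded_clinear_on_D[OF \<Theta>] B
    by (intro bounded_linear_intro[of _ B]) (auto simp: mult.commute simp flip: scaleC_of_real)
  show "closed (range \<Theta>)"
    using below by (intro complete_imp_closed complete_isometric_image[OF below(1) subspace_UNIV lin])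
      (auto simp: complete_UNIV)
  show "0 \<in> range \<Theta>"
    using linear_0[OF bounded_linear.linear[OF lin]] by (metis rangeI)
  fix x y c assume "x \<in> range \<Theta>"
  then obtain x' where x': "x = \<Theta> x'" by blast
  show "c *\<^sub>C x \<in> range \<Theta>"
    unfolding x' bounded_clinear_on_D(3)[OF \<Theta> UNIV_I, symmetric] by (rule rangeI)
  assume "y \<in> range \<Theta>"
  then obtain y' where y': "y = \<Theta> y'" by blast
  show "x + y \<in> range \<Theta>"
    unfolding x' y' bounded_clinear_on_D(2)[OF \<Theta> UNIV_I UNIV_I, symmetric] by (rule rangeI)
qed

section \<open>Orbits of commuting invertible operators\<close>

lemma operator_powi_on_step:
  assumes "bij A"
  shows "operator_powi_on UNIV A (k + 1) x = A (operator_powi_on UNIV A k x)"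
proof (cases "k \<ge> 0")
  case True
  then have "nat (k + 1) = Suc (nat k)"
    by simp
  then show ?thesis
    using True by (simp add: operator_powi_on_def)
next
  case False
  define m where "m = nat (- (k + 1))"
  have m: "nat (- k) = Suc m"
    using False by (simp add: m_def)
  have "operator_powi_on UNIV A (k + 1) x = (inv A ^^ m) x"
  proof (cases "k + 1 = 0")
    case False
    then show ?thesis
      using \<open>\<not> k \<ge> 0\<close> by (simp add: operator_powi_on_def m_def)
  qed (simp add: operator_powi_on_def m_def)
  moreover have "A (operator_powi_on UNIV A k x) = (inv A ^^ m) x"
    using False assms by (simp add: operator_powi_on_def m bij_is_surj surj_f_inv_f)
  ultimately show ?thesis
    by simp
qed

lemma operator_powi_on_commute:
  assumes "bij A" and comm: "\<And>x. A (B x) = B (A x)"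
  shows "operator_powi_on UNIV A k (B x) = B (operator_powi_on UNIV A k x)"
proof -
  have pow: "(A' ^^ n) (B x) = B ((A' ^^ n) x)" if "\<And>x. A' (B x) = B (A' x)" for A' n x
    by (induction n) (simp_all add: that)
  have "inv A (B x) = B (inv A x)" for x
    using assms by (metis bij_inv_eq_iff)
  then show ?thesis
    using pow[of A] pow[of "inv A"] comm by (simp add: operator_powi_on_def)
qed

lemma invertible_operator_on_UNIV_bij:
  assumes "invertible_operator_on UNIV A"
  shows "bij A"
  using assms unfolding invertible_operator_on_def by (metis UNIV_I bijI')

lemma bounded_clinear_inv:
  assumes "invertible_operator_on UNIV A"
  shows "bounded_clinear_on UNIV UNIV (inv A)"
proof -
  obtain B where B: "bounded_clinear_on UNIV UNIV B" "\<And>x. B (A x) = x" "\<And>x. A (B x) = x"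
    using assms by (auto simp: invertible_operator_on_def)
  then have "inv A = B"
    by (metis inv_equality)
  then show ?thesis
    using B by simp
qed

text \<open>
  The family whose frame property is in question, indexed as the orthonormal basis of the model.
\<close>

definition orbit :: "('a \<Rightarrow> 'a) \<Rightarrow> ('a \<Rightarrow> 'a) \<Rightarrow> ('i \<Rightarrow> 'a) \<Rightarrow> int \<times> int \<times> 'i \<Rightarrow> 'a" where
  "orbit T L w = (\<lambda>(k, j, i). operator_powi_on UNIV T k (operator_powi_on UNIV L j (w i)))"

lemma orbit_0: "orbit T L w (0, 0, i) = w i"
  by (simp add: orbit_def operator_powi_on_def)

lemma orbit_step1:
  assumes "bij T"
  shows "orbit T L w (k + 1, j, i) = T (orbit T L w (k, j, i))"
  using assms by (simp add: orbit_def operator_powi_on_step)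

lemma orbit_step2:
  assumes "bij T" "bij L" "\<And>x. T (L x) = L (T x)"
  shows "orbit T L w (k, j + 1, i) = L (orbit T L w (k, j, i))"
  unfolding orbit_def prod.case operator_powi_on_step[OF assms(2)]
  by (rule operator_powi_on_commute[where A = T and B = L, OF assms(1,3)])

section \<open>The analysis operator of a frame\<close>

context bilateral_shifts
begin

text \<open>
  \<open>C\<close> is a similarity from the tuple \<open>(H, T, L, w)\<close> onto the basic tuple carried by \<open>N\<close>.
\<close>

definition basic_model :: "'i set \<Rightarrow> ('h :: chilbert_space \<Rightarrow> 'h) \<Rightarrow> ('h \<Rightarrow> 'h) \<Rightarrow> ('i \<Rightarrow> 'h) \<Rightarrow>
    'b set \<Rightarrow> ('h \<Rightarrow> 'b) \<Rightarrow> bool" where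
  "basic_model I T L w N C \<longleftrightarrow> closed_csubspace N \<and> N \<subseteq> spanned I \<and>
     (\<forall>x\<in>N. U\<^sub>1 x \<in> N \<and> U\<^sub>2 x \<in> N \<and> V\<^sub>1 x \<in> N \<and> V\<^sub>2 x \<in> N) \<and>
     bounded_clinear_on UNIV N C \<and> bij_betw C UNIV N \<and>
     (\<forall>i\<in>I. C (w i) = orthogonal_projection N (e (0, 0, i))) \<and>
     (\<forall>x. U\<^sub>1 (C x) = C (T x)) \<and> (\<forall>x. U\<^sub>2 (C x) = C (L x))"

text \<open>
  The similarity maps the orbit to the orthogonal projection of the basis. This holds for \<open>w i\<close> by
  definition, and it propagates along both shifts, forwards and backwards, because \<open>C\<close> intertwines the
  operators and \<open>N\<close> reduces the shifts.
\<close>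

lemma basic_model_orbit:
  assumes model: "basic_model I T L w N C" and T: "bij T" and L: "bij L"
    and comm: "\<And>x. T (L x) = L (T x)" and i: "i \<in> I"
  shows "y \<in> N \<Longrightarrow> cinner y (C (orbit T L w (k, j, i))) = cinner y (e (k, j, i))"
proof -
  have N: "closed_csubspace N"
    and inv: "\<And>x. x \<in> N \<Longrightarrow> U\<^sub>1 x \<in> N" "\<And>x. x \<in> N \<Longrightarrow> U\<^sub>2 x \<in> N"
      "\<And>x. x \<in> N \<Longrightarrow> V\<^sub>1 x \<in> N" "\<And>x. x \<in> N \<Longrightarrow> V\<^sub>2 x \<in> N"
    and w: "C (w i) = orthogonal_projection N (e (0, 0, i))"
    and C: "\<And>x. C (T x) = U\<^sub>1 (C x)" "\<And>x. C (L x) = U\<^sub>2 (C x)"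
    using model i by (auto simp: basic_model_def)
  have up1: "cinner y (C (T v)) = cinner y (U\<^sub>1 f)"
    if "\<And>y. y \<in> N \<Longrightarrow> cinner y (C v) = cinner y f" "y \<in> N" for v f y
    using that(1)[OF inv(3)[OF that(2)]] by (simp add: C adjoint1')
  have up2: "cinner y (C (L v)) = cinner y (U\<^sub>2 f)"
    if "\<And>y. y \<in> N \<Longrightarrow> cinner y (C v) = cinner y f" "y \<in> N" for v f y
    using that(1)[OF inv(4)[OF that(2)]] by (simp add: C adjoint2')
  have down1: "cinner y (C v) = cinner y (V\<^sub>1 f)"
    if "\<And>y. y \<in> N \<Longrightarrow> cinner y (C (T v)) = cinner y f" "y \<in> N" for v f y
    using that(1)[OF inv(1)[OF that(2)]] by (simp add: C adjoint1 inverse1)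
  have down2: "cinner y (C v) = cinner y (V\<^sub>2 f)"
    if "\<And>y. y \<in> N \<Longrightarrow> cinner y (C (L v)) = cinner y f" "y \<in> N" for v f y
    using that(1)[OF inv(2)[OF that(2)]] by (simp add: C adjoint2 inverse2)
  have j: "y \<in> N \<Longrightarrow> cinner y (C (orbit T L w (0, j, i))) = cinner y (e (0, j, i))" for y
  proof (induction j arbitrary: y rule: int_induct[where k = 0])
    case base
    then show ?case
      by (simp add: orbit_0 w cinner_orthogonal_projection[OF N])
  next
    case (step1 j)
    then show ?case
      using up2[of "orbit T L w (0, j, i)" "e (0, j, i)" y]
      by (simp add: orbit_step2[of T L, OF T L comm] shift2)
  next
    case (step2 j)
    then show ?case
      using down2[of "orbit T L w (0, j - 1, i)" "e (0, j, i)" y]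
      by (simp add: orbit_step2[of T L, OF T L comm, symmetric] shift_back2)
  qed
  show "y \<in> N \<Longrightarrow> cinner y (C (orbit T L w (k, j, i))) = cinner y (e (k, j, i))"
  proof (induction k arbitrary: y rule: int_induct[where k = 0])
    case base
    then show ?case
      by (rule j)
  next
    case (step1 k)
    then show ?case
      using up1[of "orbit T L w (k, j, i)" "e (k, j, i)" y]
      by (simp add: orbit_step1[OF T] shift1)
  next
    case (step2 k)
    then show ?case
      using down1[of "orbit T L w (k - 1, j, i)" "e (k, j, i)" y]
      by (simp add: orbit_step1[OF T, symmetric] shift_back1)
  qed
qed

text \<open>
  Let \<open>D\<close> be the adjoint of the inverse of \<open>C\<close>, which is bounded by the bounded inverse theorem. For a
  basis vector \<open>e \<kappa>\<close> with last index in \<open>I\<close> one has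
  \<open>\<langle>D x, e \<kappa>\<rangle> = \<langle>D x, P\<^sub>N (e \<kappa>)\<rangle> = \<langle>D x, C (orbit \<kappa>)\<rangle> = \<langle>x, orbit \<kappa>\<rangle>\<close>. So \<open>D\<close> is the analysis operator of
  the orbit, which does not depend on \<open>N\<close> and \<open>C\<close>, whereas \<open>N\<close> is recovered as its range. Both the
  frame inequalities and the uniqueness of \<open>N\<close> follow from this.
\<close>

lemma basic_model_analysis:
  fixes T L :: "'h :: chilbert_space \<Rightarrow> 'h"
  assumes model: "basic_model I T L w N C" and T: "bij T" and L: "bij L"
    and comm: "\<And>x. T (L x) = L (T x)"
  obtains D a b where "range D = N" "a > 0" "b > 0"
    "\<And>x. norm x \<le> a * norm (D x)" "\<And>x. norm (D x) \<le> b * norm x"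
    "\<And>x k j i. cinner (D x) (e (k, j, i)) =
       (if i \<in> I then cinner x (orbit T L w (k, j, i)) else 0)"
proof -
  have N: "closed_csubspace N" and sp: "N \<subseteq> spanned I" and C: "bounded_clinear_on UNIV N C"
    and bij: "bij_betw C UNIV N"
    using model by (auto simp: basic_model_def)
  have inj: "inj C" and range: "range C = N"
    using bij by (auto simp: bij_betw_def)
  obtain a where a: "a > 0" "\<And>x. norm (C x) \<le> a * norm x"
    using bounded_clinear_on_bound[OF C] by (metis UNIV_I)
  have lin: "bounded_linear C"
    using bounded_clinear_on_D[OF C] a(2)
    by (intro bounded_linear_intro[of _ a]) (auto simp: mult.commute simp flip: scaleC_of_real)
  obtain b where b: "b > 0" "\<And>x. norm x \<le> b * norm (C x)"
    using inj_bounded_linear_bounded_below[OF lin inj] N range by (auto simp: closed_csubspace_def)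
  define G where "G = inv C"
  have GC: "G (C x) = x" for x
    by (simp add: G_def inj)
  have G_add: "G (C x + C y) = G (C x) + G (C y)" for x y
    unfolding GC using GC[of "x + y"] bounded_clinear_on_D(2)[OF C] by simp
  have G_scaleC: "G (c *\<^sub>C C x) = c *\<^sub>C G (C x)" for c x
    unfolding GC using GC[of "c *\<^sub>C x"] bounded_clinear_on_D(3)[OF C] by simp
  have G_bound: "norm (G (C x)) \<le> b * norm (C x)" for x
    unfolding GC by (rule b(2))
  have "bounded_clinear_on N UNIV G"
    unfolding bounded_clinear_on_def range[symmetric] using G_add G_scaleC G_bound by blast
  then obtain D where D: "\<And>x. D x \<in> N" "\<And>x y. y \<in> N \<Longrightarrow> cinner (G y) x = cinner y (D x)"
    using adjoint_exists[OF N] by metis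
  have CD: "cinner (C x') (D x) = cinner x' x" for x x'
    using D(2)[of "C x'" x] range by (auto simp: GC)
  obtain E where E: "\<And>x y. cinner (C y) x = cinner y (E x)"
    using adjoint_exists[OF closed_csubspace_UNIV C] by (metis UNIV_I)
  \<comment> \<open>\<open>D\<close> is onto \<open>N\<close> with the adjoint \<open>E\<close> of \<open>C\<close> as right inverse\<close>
  have "D (E y) = y" if "y \<in> N" for y
    using CD E range that by (intro cinner_ext_on[OF N D(1) that]) auto
  then have "range D = N"
    using D(1) by (metis image_subset_iff rangeI subsetI subset_antisym)
  moreover have "norm x \<le> a * norm (D x)" for x
  proof (cases "x = 0")
    case False
    have "(norm x)\<^sup>2 = cmod (cinner (C x) (D x))"
      by (simp add: CD cinner_self norm_power)
    also have "\<dots> \<le> norm (C x) * norm (D x)"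
      by (rule norm_cinner_le)
    also have "\<dots> \<le> a * norm x * norm (D x)"
      by (intro mult_right_mono a) auto
    finally show ?thesis
      using False by (simp add: power2_eq_square mult_ac)
  qed (use a in simp)
  moreover have "norm (D x) \<le> b * norm x" for x
  proof (cases "D x = 0")
    case False
    obtain x' where x': "D x = C x'"
      using D(1) range by (metis rangeE)
    have "(norm (D x))\<^sup>2 = cmod (cinner (D x) (D x))"
      by (simp add: cinner_self norm_power)
    also have "\<dots> = cmod (cinner x' x)"
      using CD[of x' x] x' by simp
    also have "\<dots> \<le> norm x' * norm x"
      by (rule norm_cinner_le)
    also have "\<dots> \<le> b * norm (D x) * norm x"
      unfolding x' by (intro mult_right_mono b) auto
    finally show ?thesis
      using False by (simp add: power2_eq_square mult_ac)
  qed (use b in simp)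
  moreover have "cinner (D x) (e (k, j, i)) = (if i \<in> I then cinner x (orbit T L w (k, j, i)) else 0)"
    for x k j i
  proof (cases "i \<in> I")
    case True
    then have "cinner (D x) (e (k, j, i)) = cinner (D x) (C (orbit T L w (k, j, i)))"
      using basic_model_orbit[where T = T and L = L, OF model T L comm _ D(1)] by simp
    also have "\<dots> = cinner x (orbit T L w (k, j, i))"
      using CD[of "orbit T L w (k, j, i)" x] cinner_commute[of "D x" "C (orbit T L w (k, j, i))"]
        cinner_commute[of x "orbit T L w (k, j, i)"] by simp
    finally show ?thesis
      using True by simp
  qed (use subsetD[OF sp D(1)] in \<open>auto simp: spanned_def\<close>)
  ultimately show ?thesis
    by (rule that[of D a b, OF _ a(1) b(1)])
qed

text \<open>
  By Parseval's identity the frame sum at \<open>x\<close> is the squared norm of its image \<open>d\<close> under the analysis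
  operator.
\<close>

lemma frame_coefficients:
  assumes "\<And>k j i. cinner d (e (k, j, i)) = (if i \<in> I then cinner x (v (k, j, i)) else 0)"
  shows "(\<lambda>\<kappa>. (cmod (cinner x (v \<kappa>)))\<^sup>2) summable_on UNIV \<times> UNIV \<times> I"
    and "(\<Sum>\<^sub>\<infinity>\<kappa>\<in>UNIV \<times> UNIV \<times> I. (cmod (cinner x (v \<kappa>)))\<^sup>2) = (norm d)\<^sup>2"
proof -
  have eq: "cinner d (e \<kappa>) = (if \<kappa> \<in> UNIV \<times> UNIV \<times> I then cinner x (v \<kappa>) else 0)" for \<kappa>
    using assms by (cases \<kappa>) auto
  show "(\<lambda>\<kappa>. (cmod (cinner x (v \<kappa>)))\<^sup>2) summable_on UNIV \<times> UNIV \<times> I"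
    using coefficients_summable[of d]
    by (rule summable_on_cong_neutral[THEN iffD1, rotated -1]) (auto simp: eq)
  show "(\<Sum>\<^sub>\<infinity>\<kappa>\<in>UNIV \<times> UNIV \<times> I. (cmod (cinner x (v \<kappa>)))\<^sup>2) = (norm d)\<^sup>2"
    unfolding norm_sq_eq_infsum by (rule infsum_cong_neutral) (auto simp: eq)
qed

lemma basic_model_frame:
  assumes "basic_model I T L w N C" "bij T" "bij L" "\<And>x. T (L x) = L (T x)"
  shows "is_frame_of UNIV (UNIV \<times> UNIV \<times> I) (orbit T L w)"
proof -
  obtain D a b where D: "a > 0" "b > 0"
    "\<And>x. norm x \<le> a * norm (D x)" "\<And>x. norm (D x) \<le> b * norm x"
    "\<And>x k j i. cinner (D x) (e (k, j, i)) = (if i \<in> I then cinner x (orbit T L w (k, j, i)) else 0)"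
    by (rule basic_model_analysis[where T = T and L = L, OF assms]) (rule that)
  have "1 / a\<^sup>2 * (norm x)\<^sup>2 \<le> (norm (D x))\<^sup>2" for x
    using power_mono[OF D(3)[of x], of 2] D(1) by (simp add: power_mult_distrib field_simps)
  moreover have "(norm (D x))\<^sup>2 \<le> b\<^sup>2 * (norm x)\<^sup>2" for x
    using power_mono[OF D(4)[of x], of 2] by (simp add: power_mult_distrib)
  ultimately show ?thesis
    unfolding is_frame_of_def using D(1,2) frame_coefficients[OF D(5)]
    by (intro conjI exI[of _ "1 / a\<^sup>2"] exI[of _ "b\<^sup>2"]) auto
qed

lemma basic_model_unique:
  assumes "basic_model I T L w N C" "basic_model I T L w N' C'"
    and "bij T" "bij L" "\<And>x. T (L x) = L (T x)"
  shows "N = N'"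
proof -
  obtain D where D: "range D = N"
    "\<And>x k j i. cinner (D x) (e (k, j, i)) = (if i \<in> I then cinner x (orbit T L w (k, j, i)) else 0)"
    by (rule basic_model_analysis[where T = T and L = L, OF assms(1,3-5)]) (rule that)
  obtain D' where D': "range D' = N'"
    "\<And>x k j i. cinner (D' x) (e (k, j, i)) = (if i \<in> I then cinner x (orbit T L w (k, j, i)) else 0)"
    by (rule basic_model_analysis[where T = T and L = L, OF assms(2,3-5)]) (rule that)
  have "D x = D' x" for x
    by (rule eqI) (metis D(2) D'(2) prod_cases3)
  then show ?thesis
    using D(1) D'(1) by auto
qed


lemma analysis_operator_exists:
  assumes bound: "\<And>x. (\<lambda>\<kappa>. (cmod (cinner x (v \<kappa>)))\<^sup>2) summable_on UNIV \<times> UNIV \<times> I"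
  obtains \<Theta> where
    "\<And>x k j i. cinner (\<Theta> x) (e (k, j, i)) = (if i \<in> I then cinner x (v (k, j, i)) else 0)"
proof -
  have "\<exists>y. \<forall>k j i. cinner y (e (k, j, i)) = (if i \<in> I then cinner x (v (k, j, i)) else 0)" for x
  proof -
    define c where "c \<kappa> = (if \<kappa> \<in> UNIV \<times> UNIV \<times> I then cinner x (v \<kappa>) else 0)" for \<kappa>
    have "(\<lambda>\<kappa>. (cmod (c \<kappa>))\<^sup>2) summable_on UNIV"
      using bound[of x]
      by (rule summable_on_cong_neutral[THEN iffD1, rotated -1]) (auto simp: c_def)
    then have "ell2_coeff (Abs_ell2 c) = c"
      by (simp add: Abs_ell2_inverse)
    moreover obtain y where "coords y = Abs_ell2 c"
      using riesz_fischer by metis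
    ultimately have "cinner y (e \<kappa>) = c \<kappa>" for \<kappa>
      by (metis coeff_coords)
    then show ?thesis
      by (intro exI[of _ y]) (simp add: c_def)
  qed
  then show ?thesis
    using that by metis
qed

text \<open>
  The carrier \<open>N\<close> must be the range of the analysis operator \<open>\<Theta>\<close>. It is closed by the lower frame bound.
  Shifting the coordinates of \<open>\<Theta> x\<close> amounts to applying the adjoint of \<open>T\<close>, of \<open>L\<close> or of their inverses
  to \<open>x\<close>, so \<open>N\<close> is reducing. The similarity \<open>C h\<close> is the vector of \<open>N\<close> determined by
  \<open>\<langle>\<Theta> x, C h\<rangle> = \<langle>x, h\<rangle>\<close> for all \<open>x\<close>; all its properties are read off from this identity.
\<close>

lemma frame_basic_model:
  fixes T L :: "'h :: chilbert_space \<Rightarrow> 'h"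
  assumes T: "invertible_operator_on UNIV T" and L: "invertible_operator_on UNIV L"
    and comm: "\<And>x. T (L x) = L (T x)"
    and frame: "is_frame_of UNIV (UNIV \<times> UNIV \<times> I) (orbit T L w)"
  obtains N C where "basic_model I T L w N C"
proof -
  note bijT = invertible_operator_on_UNIV_bij[OF T] and bijL = invertible_operator_on_UNIV_bij[OF L]
  define v where "v = orbit T L w"
  have v1: "v (k + 1, j, i) = T (v (k, j, i))" and v2: "v (k, j + 1, i) = L (v (k, j, i))"
    and v0: "v (0, 0, i) = w i" for k j i
    by (simp_all add: v_def orbit_0 orbit_step1[OF bijT] orbit_step2[of T L, OF bijT bijL comm])
  have v3: "v (k - 1, j, i) = inv T (v (k, j, i))" and v4: "v (k, j - 1, i) = inv L (v (k, j, i))" for k j i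
    using v1[of "k - 1" j i] v2[of k "j - 1" i] bijT bijL
    by (metis bij_inv_eq_iff diff_add_cancel)+
  obtain A B where AB: "A > 0" "B > 0"
    and sums: "\<And>x. (\<lambda>\<kappa>. (cmod (cinner x (v \<kappa>)))\<^sup>2) summable_on UNIV \<times> UNIV \<times> I"
    and lower: "\<And>x. A * (norm x)\<^sup>2 \<le> (\<Sum>\<^sub>\<infinity>\<kappa>\<in>UNIV \<times> UNIV \<times> I. (cmod (cinner x (v \<kappa>)))\<^sup>2)"
    and upper: "\<And>x. (\<Sum>\<^sub>\<infinity>\<kappa>\<in>UNIV \<times> UNIV \<times> I. (cmod (cinner x (v \<kappa>)))\<^sup>2) \<le> B * (norm x)\<^sup>2"
    using frame unfolding is_frame_of_def v_def by blast
  obtain \<Theta> where \<Theta>: "\<And>x k j i. cinner (\<Theta> x) (e (k, j, i)) = (if i \<in> I then cinner x (v (k, j, i)) else 0)"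
    using analysis_operator_exists[OF sums] by metis
  have \<Theta>_eqI: "\<Theta> x = y" if "\<And>k j i. (if i \<in> I then cinner x (v (k, j, i)) else 0) = cinner y (e (k, j, i))" for x y
    by (rule eqI) (metis \<Theta> that prod_cases3)
  have \<Theta>_norm: "(norm (\<Theta> x))\<^sup>2 = (\<Sum>\<^sub>\<infinity>\<kappa>\<in>UNIV \<times> UNIV \<times> I. (cmod (cinner x (v \<kappa>)))\<^sup>2)" for x
    using frame_coefficients(2)[OF \<Theta>] by simp
  have \<Theta>_upper: "norm (\<Theta> x) \<le> sqrt B * norm x" for x
  proof (rule power2_le_imp_le)
    show "(norm (\<Theta> x))\<^sup>2 \<le> (sqrt B * norm x)\<^sup>2"
      unfolding \<Theta>_norm power_mult_distrib real_sqrt_pow2[OF less_imp_le[OF AB(2)]] by (rule upper)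
  qed (use AB in simp)
  have \<Theta>_lower: "sqrt A * norm x \<le> norm (\<Theta> x)" for x
  proof (rule power2_le_imp_le)
    show "(sqrt A * norm x)\<^sup>2 \<le> (norm (\<Theta> x))\<^sup>2"
      unfolding \<Theta>_norm power_mult_distrib real_sqrt_pow2[OF less_imp_le[OF AB(1)]] by (rule lower)
  qed simp
  have \<Theta>_add: "\<Theta> (x + y) = \<Theta> x + \<Theta> y" and \<Theta>_scaleC: "\<Theta> (c *\<^sub>C x) = c *\<^sub>C \<Theta> x" for x y c
    by (rule \<Theta>_eqI, simp add: cinner_add_left cinner_scaleC_left \<Theta>)+
  have \<Theta>_bounded: "bounded_clinear_on UNIV UNIV \<Theta>"
    using \<Theta>_upper by (auto simp: bounded_clinear_on_def \<Theta>_add \<Theta>_scaleC)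
  define N where "N = range \<Theta>"
  have N: "closed_csubspace N"
    unfolding N_def using AB \<Theta>_lower by (intro range_closed_csubspace[OF \<Theta>_bounded, of "sqrt A"]) auto

  \<comment> \<open>if \<open>P\<close> shifts the basis as \<open>R\<close> moves the orbit, then the adjoint \<open>Q\<close> of \<open>P\<close> acts on \<open>\<Theta>\<close> as the adjoint of \<open>R\<close>\<close>
  have intertwine: "\<exists>R'. (\<forall>x y. cinner (R x) y = cinner x (R' y)) \<and> (\<forall>x. Q (\<Theta> x) = \<Theta> (R' x))"
    if R: "bounded_clinear_on UNIV UNIV R" and Q: "\<And>x y. cinner (Q x) y = cinner x (P y)"
      and P: "\<And>k j i. P (e (k, j, i)) = e (f k, g j, i)" and v: "\<And>k j i. v (f k, g j, i) = R (v (k, j, i))"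
    for R Q P f g
  proof -
    obtain R' where R': "\<And>x y. cinner (R x) y = cinner x (R' y)"
      using adjoint_exists[OF closed_csubspace_UNIV R] by (metis UNIV_I)
    have "cinner x (R y) = cinner (R' x) y" for x y
      using R' by (metis cinner_commute)
    then have "\<Theta> (R' x) = Q (\<Theta> x)" for x
      by (intro \<Theta>_eqI) (simp add: Q P \<Theta> v)
    then show ?thesis
      using R' by auto
  qed
  have bT: "bounded_clinear_on UNIV UNIV T" and bL: "bounded_clinear_on UNIV UNIV L"
    using T L by (auto simp: invertible_operator_on_def)
  obtain T' where T': "\<And>x y. cinner (T x) y = cinner x (T' y)" "\<And>x. V\<^sub>1 (\<Theta> x) = \<Theta> (T' x)"
    using intertwine[OF bT adjoint1', of "\<lambda>k. k + 1" "\<lambda>j. j"] by (auto simp: shift1 v1)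
  obtain L' where L': "\<And>x y. cinner (L x) y = cinner x (L' y)" "\<And>x. V\<^sub>2 (\<Theta> x) = \<Theta> (L' x)"
    using intertwine[OF bL adjoint2', of "\<lambda>k. k" "\<lambda>j. j + 1"] by (auto simp: shift2 v2)
  obtain S' where S': "\<And>x. U\<^sub>1 (\<Theta> x) = \<Theta> (S' x)"
    using intertwine[OF bounded_clinear_inv[OF T] adjoint1, of "\<lambda>k. k - 1" "\<lambda>j. j"]
    by (auto simp: shift_back1 v3)
  obtain R' where R': "\<And>x. U\<^sub>2 (\<Theta> x) = \<Theta> (R' x)"
    using intertwine[OF bounded_clinear_inv[OF L] adjoint2, of "\<lambda>k. k" "\<lambda>j. j - 1"]
    by (auto simp: shift_back2 v4)
  have invariant: "\<forall>x\<in>N. U\<^sub>1 x \<in> N \<and> U\<^sub>2 x \<in> N \<and> V\<^sub>1 x \<in> N \<and> V\<^sub>2 x \<in> N"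
    by (auto simp: N_def T' L' S' R')

  \<comment> \<open>existence: apply the adjoint of the inverse of \<open>\<Theta>\<close> on its range\<close>
  have "\<exists>c\<in>N. \<forall>x. cinner (\<Theta> x) c = cinner x h" for h
  proof -
    define G where "G = inv \<Theta>"
    have "inj \<Theta>"
    proof (rule injI)
      fix x y assume "\<Theta> x = \<Theta> y"
      then have "\<Theta> (x - y) = 0"
        using \<Theta>_add[of "x - y" y] by simp
      then show "x = y"
        using \<Theta>_lower[of "x - y"] AB by (simp add: mult_le_0_iff)
    qed
    then have G\<Theta>: "G (\<Theta> x) = x" for x
      by (simp add: G_def)
    have G_add: "G (\<Theta> x + \<Theta> y) = G (\<Theta> x) + G (\<Theta> y)" and G_scaleC: "G (c *\<^sub>C \<Theta> x) = c *\<^sub>C G (\<Theta> x)" for x y c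
      unfolding \<Theta>_add[symmetric] \<Theta>_scaleC[symmetric] G\<Theta> by (rule refl)+
    have "norm x \<le> inverse (sqrt A) * norm (\<Theta> x)" for x
      using \<Theta>_lower[of x] AB by (simp add: field_simps)
    then have "bounded_clinear_on N UNIV G"
      unfolding bounded_clinear_on_def N_def using G_add G_scaleC by (auto simp: G\<Theta>)
    then obtain G' where G': "\<And>x. G' x \<in> N" "\<And>x y. y \<in> N \<Longrightarrow> cinner (G y) x = cinner y (G' x)"
      using adjoint_exists[OF N] by metis
    have "cinner (\<Theta> x) (G' h) = cinner x h" for x
      using G'(2)[of "\<Theta> x" h] by (simp add: N_def G\<Theta>)
    then show ?thesis
      using G'(1) by blast
  qed
  then obtain C where C: "\<And>h. C h \<in> N" "\<And>h x. cinner (\<Theta> x) (C h) = cinner x h"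
    by metis
  have C_eqI: "C h = c" if "c \<in> N" "\<And>x. cinner (\<Theta> x) c = cinner x h" for c h
    by (rule cinner_ext_on[OF N C(1) that(1)]) (auto simp: N_def C(2) that(2))
  have C_add: "C (h + h') = C h + C h'" for h h'
    using N C by (intro C_eqI) (auto simp: cinner_add_right closed_csubspace_def)
  have C_scaleC: "C (c *\<^sub>C h) = c *\<^sub>C C h" for c h
    using N C by (intro C_eqI) (auto simp: cinner_scaleC_right closed_csubspace_def)
  have C_bound: "norm (C h) \<le> inverse (sqrt A) * norm h" for h
  proof (cases "C h = 0")
    case False
    obtain x where x: "C h = \<Theta> x"
      using C(1)[of h] by (auto simp: N_def)
    have "(norm (C h))\<^sup>2 = cmod (cinner (C h) (C h))"
      by (simp add: cinner_self norm_power)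
    also have "\<dots> = cmod (cinner x h)"
      using C(2)[of x h] x by simp
    also have "\<dots> \<le> norm x * norm h"
      by (rule norm_cinner_le)
    also have "\<dots> \<le> inverse (sqrt A) * norm (C h) * norm h"
      using \<Theta>_lower[of x] AB x by (intro mult_right_mono) (auto simp: field_simps)
    finally show ?thesis
      using False by (simp add: power2_eq_square mult_ac)
  qed (use AB in simp)
  have C_bounded: "bounded_clinear_on UNIV N C"
    using C(1) C_bound by (auto simp: bounded_clinear_on_def C_add C_scaleC)
  have "inj C"
  proof (rule injI)
    fix h h' assume "C h = C h'"
    then show "h = h'"
      using C(2) by (intro cinner_ext) metis
  qed
  moreover have "range C = N"
  proof
    obtain D where D: "\<And>x y. cinner (\<Theta> x) y = cinner x (D y)"
      using adjoint_exists[OF closed_csubspace_UNIV \<Theta>_bounded] by (metis UNIV_I)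
    \<comment> \<open>the adjoint of \<open>\<Theta>\<close> is a right inverse of \<open>C\<close>\<close>
    have "C (D y) = y" if "y \<in> N" for y
      using that D by (intro C_eqI)
    then show "N \<subseteq> range C"
      by (metis rangeI subsetI)
  qed (use C(1) in auto)
  ultimately have bij: "bij_betw C UNIV N"
    by (simp add: bij_betw_def)
  have w: "C (w i) = orthogonal_projection N (e (0, 0, i))" if "i \<in> I" for i
  proof (rule C_eqI[OF orthogonal_projection_mem[OF N]])
    show "cinner (\<Theta> x) (orthogonal_projection N (e (0, 0, i))) = cinner x (w i)" for x
      using that by (subst cinner_orthogonal_projection[OF N]) (auto simp: N_def \<Theta> v0)
  qed
  have T: "C (T x) = U\<^sub>1 (C x)" for x
  proof (rule C_eqI)
    show "cinner (\<Theta> y) (U\<^sub>1 (C x)) = cinner y (T x)" for y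
    proof -
      have "cinner (\<Theta> y) (U\<^sub>1 (C x)) = cinner (T' y) x"
        by (simp add: T'(2) C(2) flip: adjoint1')
      also have "\<dots> = cinner y (T x)"
        using T'(1)[of x y] cinner_commute[of "T' y" x] cinner_commute[of y "T x"] by simp
      finally show ?thesis .
    qed
  qed (use invariant C(1) in blast)
  have L: "C (L x) = U\<^sub>2 (C x)" for x
  proof (rule C_eqI)
    show "cinner (\<Theta> y) (U\<^sub>2 (C x)) = cinner y (L x)" for y
    proof -
      have "cinner (\<Theta> y) (U\<^sub>2 (C x)) = cinner (L' y) x"
        by (simp add: L'(2) C(2) flip: adjoint2')
      also have "\<dots> = cinner y (L x)"
        using L'(1)[of x y] cinner_commute[of "L' y" x] cinner_commute[of y "L x"] by simp
      finally show ?thesis .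
    qed
  qed (use invariant C(1) in blast)
  have "N \<subseteq> spanned I"
    by (auto simp: N_def spanned_def \<Theta>)
  then show ?thesis
    using N invariant C_bounded bij w by (intro that[of N C]) (simp add: basic_model_def T L)
qed

end

section \<open>Fourier analysis on the torus\<close>

lemma measurable_power_int [measurable (raw)]:
  fixes f :: "'a \<Rightarrow> complex"
  assumes [measurable]: "f \<in> borel_measurable M"
  shows "(\<lambda>x. f x powi k) \<in> borel_measurable M"
  unfolding power_int_def by measurable

lemma integral_circle_power:
  "(\<integral>z. z powi k \<partial>circle_measure) = (if k = 0 then 1 else 0)"
proof (cases "k = 0")
  case True
  then show ?thesis
    using prob_space.prob_space[OF prob_space_circle_measure] by simp
next
  case False
  have cis: "cis \<in> uniform_measure lborel {0..<2 * pi} \<rightarrow>\<^sub>M restrict_space borel (sphere 0 1)"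
  proof (rule measurable_restrict_space2)
    have "cis \<in> borel_measurable borel"
      by (intro borel_measurable_continuous_onI continuous_intros)
    then show "cis \<in> borel_measurable (uniform_measure lborel {0..<2 * pi})"
      by simp
  qed simp
  have "indicator {0..<2 * pi} t / emeasure lborel {0..<2 * pi} = ennreal (indicator {0..<2 * pi} t / (2 * pi))" for t
    using divide_ennreal[of 1 "2 * pi"] by (auto simp: indicator_def)
  then have uniform_measure_eq: "uniform_measure lborel {0..<2 * pi}
      = density lborel (\<lambda>t. ennreal (indicator {0..<2 * pi} t / (2 * pi)))"
    unfolding uniform_measure_def by presburger
  have meas: "(\<lambda>t. cis (of_int k * t)) \<in> borel_measurable borel"
    by (intro borel_measurable_continuous_onI continuous_intros)
  \<comment> \<open>an antiderivative with period \<open>2\<pi>\<close>\<close>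
  define F where "F t = cis (of_int k * t) / (\<i> * of_int k)" for t
  have deriv: "(F has_vector_derivative cis (of_int k * t)) (at t within A)" for t A
    unfolding F_def using False
    by (auto intro!: derivative_eq_intros simp: has_vector_derivative_def scaleR_conv_of_real mult_ac)
  have "(\<integral>z. z powi k \<partial>circle_measure)
      = (\<integral>t. cis t powi k \<partial>uniform_measure lborel {0..<2 * pi})"
    unfolding circle_measure_def
    by (rule integral_distr[OF cis]) (auto intro!: measurable_power_int measurable_restrict_space1)
  also have "\<dots> = (\<integral>t. (indicator {0..<2 * pi} t / (2 * pi)) *\<^sub>R cis (of_int k * t) \<partial>lborel)"
    unfolding uniform_measure_eq cis_power_int
    using meas by (intro integral_density) (auto simp: AE_I2)
  also have "\<dots> = (1 / (2 * pi)) *\<^sub>R (\<integral>t. indicator {0..2 * pi} t *\<^sub>R cis (of_int k * t) \<partial>lborel)"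
  proof -
    have "AE t in lborel. t \<noteq> 2 * pi"
      by (rule AE_lborel_singleton)
    then have "AE t in lborel. (indicator {0..<2 * pi} t / (2 * pi)) *\<^sub>R cis (of_int k * t)
        = (1 / (2 * pi)) *\<^sub>R (indicator {0..2 * pi} t *\<^sub>R cis (of_int k * t))"
      by eventually_elim (auto simp: indicator_def)
    then have "(\<integral>t. (indicator {0..<2 * pi} t / (2 * pi)) *\<^sub>R cis (of_int k * t) \<partial>lborel)
        = (\<integral>t. (1 / (2 * pi)) *\<^sub>R (indicator {0..2 * pi} t *\<^sub>R cis (of_int k * t)) \<partial>lborel)"
      using meas by (intro integral_cong_AE) (simp_all, measurable)
    moreover have "integrable lborel (\<lambda>t. indicator {0..2 * pi} t *\<^sub>R cis (of_int k * t))"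
      unfolding set_integrable_def[symmetric]
      by (intro borel_integrable_atLeastAtMost' continuous_intros)
    ultimately show ?thesis
      by (simp only: integral_scaleR_right)
  qed
  also have "(\<integral>t. indicator {0..2 * pi} t *\<^sub>R cis (of_int k * t) \<partial>lborel) = F (2 * pi) - F 0"
    by (intro integral_FTC_atLeastAtMost deriv) (auto intro!: continuous_intros)
  also have "F (2 * pi) = F 0"
    by (simp add: F_def) (metis cis_multiple_2pi Ints_of_int mult.assoc mult.commute)
  finally show ?thesis
    using False by simp
qed

definition torus_char :: "int \<Rightarrow> int \<Rightarrow> complex \<times> complex \<Rightarrow> complex" where
  "torus_char k j z = fst z powi k * snd z powi j"

lemma measurable_torus_char [measurable]: "torus_char k j \<in> borel_measurable torus_measure"
  unfolding torus_char_def by measurable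

lemma torus_char_0 [simp]: "torus_char 0 0 z = 1"
  by (simp add: torus_char_def)

lemma
  assumes "z \<in> space torus_measure"
  shows norm_torus_char: "cmod (torus_char k j z) = 1"
    and torus_char_mult: "torus_char k j z * torus_char k' j' z = torus_char (k + k') (j + j') z"
    and cnj_torus_char: "cnj (torus_char k j z) = torus_char (- k) (- j) z"
    and fst_torus_eq: "fst z = torus_char 1 0 z" and snd_torus_eq: "snd z = torus_char 0 1 z"
proof -
  have z: "cmod (fst z) = 1" "cmod (snd z) = 1" "fst z \<noteq> 0" "snd z \<noteq> 0"
    using assms by (auto simp: space_torus_measure mem_Times_iff)
  have cnj: "cnj (fst z) = inverse (fst z)" "cnj (snd z) = inverse (snd z)"
    using z by (simp_all add: inverse_eq_divide complex_div_cnj[of 1])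
  show "cmod (torus_char k j z) = 1"
    by (simp add: torus_char_def norm_mult norm_power_int z)
  show "torus_char k j z * torus_char k' j' z = torus_char (k + k') (j + j') z"
    by (simp add: torus_char_def power_int_add z)
  show "cnj (torus_char k j z) = torus_char (- k) (- j) z"
    by (simp add: torus_char_def cnj power_int_minus power_int_inverse)
  show "fst z = torus_char 1 0 z" "snd z = torus_char 0 1 z"
    by (simp_all add: torus_char_def)
qed

lemma integrable_torus_char_mult:
  fixes \<phi> :: "complex \<times> complex \<Rightarrow> complex"
  assumes "integrable torus_measure \<phi>"
  shows "integrable torus_measure (\<lambda>z. torus_char k j z * \<phi> z)"
proof (rule Bochner_Integration.integrable_bound[OF assms])
  show "AE z in torus_measure. norm (torus_char k j z * \<phi> z) \<le> norm (\<phi> z)"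
    by (intro AE_I2) (simp add: norm_mult norm_torus_char)
qed (use assms in measurable)

lemma integral_torus_char:
  "(\<integral>z. torus_char k j z \<partial>torus_measure) = (if k = 0 \<and> j = 0 then 1 else 0)"
proof -
  interpret circle: prob_space circle_measure
    by (rule prob_space_circle_measure)
  interpret pair_prob_space circle_measure circle_measure ..
  have "integrable (circle_measure \<Otimes>\<^sub>M circle_measure) (torus_char k j)"
    using integrable_torus_char_mult[of "\<lambda>_. 1" k j] prob_space.finite_measure[OF prob_space_torus_measure]
    by (simp add: torus_measure_def finite_measure.integrable_const)
  then have "(\<integral>z. torus_char k j z \<partial>torus_measure)
      = (\<integral>x. (\<integral>y. torus_char k j (x, y) \<partial>circle_measure) \<partial>circle_measure)"
    unfolding torus_measure_def by (rule integral_fst'[symmetric])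
  also have "\<dots> = (\<integral>x. x powi k * (if j = 0 then 1 else 0) \<partial>circle_measure)"
    by (simp add: torus_char_def integral_circle_power)
  also have "\<dots> = (if k = 0 \<and> j = 0 then 1 else 0)"
    by (simp add: integral_circle_power)
  finally show ?thesis .
qed

text \<open>
  The product \<sigma>-algebra of the two circles is the trace of the Borel sets, so that the uniqueness theorem
  below can argue with closed subsets of \<^typ>\<open>complex \<times> complex\<close>.
\<close>

lemma sets_torus_measure_borel:
  assumes "A \<in> sets torus_measure"
  obtains B where "B \<in> sets borel" "A = B \<inter> space torus_measure"
proof -
  let ?S = "sphere 0 1 :: complex set"
  let ?R = "restrict_space borel (?S \<times> ?S)"
  have sets: "sets circle_measure = sets (restrict_space borel ?S)"
    by (simp add: circle_measure_def)
  have f: "fst \<in> ?R \<rightarrow>\<^sub>M circle_measure" and s: "snd \<in> ?R \<rightarrow>\<^sub>M circle_measure"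
    unfolding measurable_cong_sets[OF refl sets]
    by (intro measurable_restrict_space2 measurable_restrict_space1 borel_measurable_continuous_onI continuous_intros;
        auto simp: space_restrict_space)+
  have "(\<lambda>z. (fst z, snd z)) \<in> ?R \<rightarrow>\<^sub>M torus_measure"
    unfolding torus_measure_def by (intro measurable_Pair f s)
  from measurable_sets[OF this assms] have "A \<inter> (?S \<times> ?S) \<in> sets ?R"
    by (simp add: space_restrict_space vimage_def)
  moreover have "A \<subseteq> ?S \<times> ?S"
    using sets.sets_into_space[OF assms] by (simp add: space_torus_measure)
  ultimately obtain B where "B \<in> sets borel" "A = B \<inter> (?S \<times> ?S)"
    by (auto simp: sets_restrict_space Int_absorb2)
  then show ?thesis
    using that by (simp add: space_torus_measure)
qed

text \<open>
  The integrable functions all of whose Fourier coefficients vanish. The point is that this class is a module over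
  the characters, hence over the real polynomial functions, whose restrictions to the torus are
  trigonometric polynomials.
\<close>

definition fourier_null :: "(complex \<times> complex \<Rightarrow> complex) \<Rightarrow> bool" where
  "fourier_null \<phi> \<longleftrightarrow> integrable torus_measure \<phi> \<and> (\<forall>k j. (\<integral>z. torus_char k j z * \<phi> z \<partial>torus_measure) = 0)"

lemma fourier_null_cong:
  assumes "fourier_null \<phi>" "\<And>z. z \<in> space torus_measure \<Longrightarrow> \<phi> z = \<psi> z"
  shows "fourier_null \<psi>"
  using assms unfolding fourier_null_def
  by (metis (no_types, lifting) Bochner_Integration.integral_cong Bochner_Integration.integrable_cong)

lemma fourier_null_add:
  assumes "fourier_null \<phi>" "fourier_null \<psi>"
  shows "fourier_null (\<lambda>z. \<phi> z + \<psi> z)"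
  using assms integrable_torus_char_mult
  by (auto simp: fourier_null_def distrib_left)

lemma fourier_null_scale:
  assumes "fourier_null \<phi>"
  shows "fourier_null (\<lambda>z. c * \<phi> z)"
  using assms by (auto simp: fourier_null_def mult.left_commute[of _ c])

lemma fourier_null_char:
  assumes "fourier_null \<phi>"
  shows "fourier_null (\<lambda>z. torus_char k j z * \<phi> z)"
  unfolding fourier_null_def
proof (intro conjI allI)
  show "integrable torus_measure (\<lambda>z. torus_char k j z * \<phi> z)"
    using assms by (intro integrable_torus_char_mult) (simp add: fourier_null_def)
  fix k' j'
  have "(\<integral>z. torus_char k' j' z * (torus_char k j z * \<phi> z) \<partial>torus_measure)
      = (\<integral>z. torus_char (k' + k) (j' + j) z * \<phi> z \<partial>torus_measure)"
    by (intro Bochner_Integration.integral_cong refl) (simp add: torus_char_mult flip: mult.assoc)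
  then show "(\<integral>z. torus_char k' j' z * (torus_char k j z * \<phi> z) \<partial>torus_measure) = 0"
    using assms by (simp add: fourier_null_def)
qed

lemma fourier_null_polynomial:
  assumes "real_polynomial_function p"
  shows "fourier_null \<phi> \<Longrightarrow> fourier_null (\<lambda>z. complex_of_real (p z) * \<phi> z)"
  using assms
proof (induction p arbitrary: \<phi>)
  case (linear f)
  note null = linear(2)
  interpret bounded_linear f by (rule linear(1))
  \<comment> \<open>a real linear form on the torus is a combination of \<open>z\<^sub>1, z\<^sub>2\<close> and their conjugates\<close>
  define a where "a = Complex (f (1, 0) / 2) (- f (\<i>, 0) / 2)"
  define b where "b = Complex (f (0, 1) / 2) (- f (0, \<i>) / 2)"
  have f_eq: "complex_of_real (f z) = a * fst z + cnj a * cnj (fst z) + b * snd z + cnj b * cnj (snd z)" for z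
  proof -
    have "z = Re (fst z) *\<^sub>R (1, 0) + Im (fst z) *\<^sub>R (\<i>, 0) + Re (snd z) *\<^sub>R (0, 1) + Im (snd z) *\<^sub>R (0, \<i>)"
      by (simp add: prod_eq_iff complex_eq_iff)
    then have "f z = Re (fst z) * f (1, 0) + Im (fst z) * f (\<i>, 0) + Re (snd z) * f (0, 1) + Im (snd z) * f (0, \<i>)"
      using add scaleR by (metis real_scaleR_def)
    then show ?thesis
      by (simp add: complex_eq_iff a_def b_def algebra_simps)
  qed
  have "fourier_null (\<lambda>z. a * (torus_char 1 0 z * \<phi> z) + cnj a * (torus_char (- 1) 0 z * \<phi> z)
      + b * (torus_char 0 1 z * \<phi> z) + cnj b * (torus_char 0 (- 1) z * \<phi> z))"
    by (intro fourier_null_add fourier_null_scale fourier_null_char null)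
  then show ?case
  proof (rule fourier_null_cong)
    fix z assume z: "z \<in> space torus_measure"
    show "a * (torus_char 1 0 z * \<phi> z) + cnj a * (torus_char (- 1) 0 z * \<phi> z)
        + b * (torus_char 0 1 z * \<phi> z) + cnj b * (torus_char 0 (- 1) z * \<phi> z) = complex_of_real (f z) * \<phi> z"
      unfolding f_eq fst_torus_eq[OF z] snd_torus_eq[OF z]
      using cnj_torus_char[OF z, of 1 0] cnj_torus_char[OF z, of 0 1] by (simp add: algebra_simps)
  qed
next
  case (const c)
  then show ?case
    by (intro fourier_null_scale)
next
  case (add f g)
  then show ?case
    using fourier_null_add[OF add(3)[OF add(5)] add(4)[OF add(5)]] by (simp add: distrib_right)
next
  case (mult f g)
  then show ?case
    using mult(3)[OF mult(4)[OF mult(5)]] by (simp add: mult.assoc)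
qed

text \<open>
  Trigonometric polynomials are dense in the continuous functions by the Stone-Weierstrass theorem.
\<close>

lemma fourier_null_continuous:
  fixes g :: "complex \<times> complex \<Rightarrow> real"
  assumes \<phi>: "fourier_null \<phi>" and g: "continuous_on UNIV g"
  shows "(\<integral>z. complex_of_real (g z) * \<phi> z \<partial>torus_measure) = 0"
proof -
  let ?S = "sphere 0 1 \<times> sphere 0 1 :: (complex \<times> complex) set"
  have "compact ?S"
    by (intro compact_Times compact_sphere)
  have int: "integrable torus_measure \<phi>"
    using \<phi> by (simp add: fourier_null_def)
  have meas_g: "g \<in> borel_measurable torus_measure"
  proof -
    have "(\<lambda>z. (fst z, snd z)) \<in> borel_measurable torus_measure"
      by measurable
    from measurable_compose[OF this borel_measurable_continuous_onI[OF g]] show ?thesis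
      by simp
  qed
  define J where "J = (\<integral>z. norm (\<phi> z) \<partial>torus_measure)"
  have "cmod (\<integral>z. complex_of_real (g z) * \<phi> z \<partial>torus_measure) \<le> \<epsilon> * J" if \<epsilon>: "\<epsilon> > 0" for \<epsilon>
  proof -
    obtain p where p: "real_polynomial_function p" "\<And>z. z \<in> ?S \<Longrightarrow> \<bar>g z - p z\<bar> < \<epsilon>"
      using Stone_Weierstrass_real_polynomial_function[OF \<open>compact ?S\<close> continuous_on_subset[OF g] \<epsilon>] by blast
    have null: "fourier_null (\<lambda>z. complex_of_real (p z) * \<phi> z)"
      by (rule fourier_null_polynomial[OF p(1) \<phi>])
    have int_p: "integrable torus_measure (\<lambda>z. complex_of_real (p z) * \<phi> z)"
      using null by (simp add: fourier_null_def)
    have zero_p: "(\<integral>z. complex_of_real (p z) * \<phi> z \<partial>torus_measure) = 0"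
      using null unfolding fourier_null_def by (metis (no_types, lifting) Bochner_Integration.integral_cong mult_1 torus_char_0)
    have bound: "norm (complex_of_real (g z) * \<phi> z - complex_of_real (p z) * \<phi> z) \<le> \<epsilon> * norm (\<phi> z)"
      if "z \<in> space torus_measure" for z
      using p(2)[of z] that
      by (auto simp: space_torus_measure norm_mult simp flip: left_diff_distrib of_real_diff intro!: mult_right_mono)
    have int_d: "integrable torus_measure (\<lambda>z. complex_of_real (g z) * \<phi> z - complex_of_real (p z) * \<phi> z)"
    proof (rule Bochner_Integration.integrable_bound)
      show "integrable torus_measure (\<lambda>z. \<epsilon> * norm (\<phi> z))"
        using int by simp
      show "AE z in torus_measure. norm (complex_of_real (g z) * \<phi> z - complex_of_real (p z) * \<phi> z) \<le> norm (\<epsilon> * norm (\<phi> z))"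
        using bound by (intro AE_I2) (smt (verit) real_norm_def)
    qed (use meas_g int int_p in measurable)
    have "(\<integral>z. complex_of_real (g z) * \<phi> z \<partial>torus_measure)
        = (\<integral>z. (complex_of_real (g z) * \<phi> z - complex_of_real (p z) * \<phi> z) + complex_of_real (p z) * \<phi> z \<partial>torus_measure)"
      by simp
    also have "\<dots> = (\<integral>z. complex_of_real (g z) * \<phi> z - complex_of_real (p z) * \<phi> z \<partial>torus_measure)"
      by (subst Bochner_Integration.integral_add[OF int_d int_p]) (simp add: zero_p)
    also have "cmod \<dots> \<le> (\<integral>z. \<epsilon> * norm (\<phi> z) \<partial>torus_measure)"
      using int bound by (intro Bochner_Integration.integral_norm_bound_integral int_d) auto
    finally show ?thesis
      by (simp add: J_def)
  qed
  moreover have "J \<ge> 0"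
    by (simp add: J_def)
  ultimately have "cmod (\<integral>z. complex_of_real (g z) * \<phi> z \<partial>torus_measure) \<le> 0 + e" if "e > 0" for e
    using that
    by (smt (verit, best) divide_pos_pos mult_left_mono nonzero_eq_divide_eq)
  then have "cmod (\<integral>z. complex_of_real (g z) * \<phi> z \<partial>torus_measure) \<le> 0"
    by (rule field_le_epsilon)
  then show ?thesis
    by simp
qed

text \<open>
  Indicators of closed sets are bounded limits of continuous functions, so \<open>\<phi>\<close> has integral zero over
  closed sets. The sets with this property form a Dynkin system, hence it holds for all Borel sets, and
  \<open>\<phi>\<close> vanishes almost everywhere.
\<close>

lemma fourier_null_AE_zero:
  assumes \<phi>: "fourier_null \<phi>"
  shows "AE z in torus_measure. \<phi> z = 0"
proof -
  let ?M = torus_measure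
  interpret prob_space ?M
    by (rule prob_space_torus_measure)
  have int: "integrable ?M \<phi>"
    using \<phi> by (simp add: fourier_null_def)
  have id: "(\<lambda>z. z) \<in> borel_measurable ?M"
  proof -
    have "(\<lambda>z. (fst z, snd z)) \<in> borel_measurable ?M"
      by measurable
    then show ?thesis by simp
  qed
  have meas: "indicator B \<in> borel_measurable ?M" if "B \<in> sets borel" for B :: "(complex \<times> complex) set"
    using measurable_compose[OF id borel_measurable_indicator[OF that]] by simp
  have int_B: "integrable ?M (\<lambda>z. indicator B z *\<^sub>R \<phi> z)" if "B \<in> sets borel" for B
  proof (rule Bochner_Integration.integrable_bound[OF int])
    show "(\<lambda>z. indicator B z *\<^sub>R \<phi> z) \<in> borel_measurable ?M"
      by (intro borel_measurable_scaleR meas that borel_measurable_integrable[OF int])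
  qed (auto simp: indicator_def)
  have UNIV: "(\<integral>z. \<phi> z \<partial>?M) = 0"
    using fourier_null_continuous[OF \<phi>, of "\<lambda>_. 1"] by simp
  have zero_closed: "(\<integral>z. indicator B z *\<^sub>R \<phi> z \<partial>?M) = 0" if B: "closed B" for B
  proof (cases "B = {}")
    case False
    \<comment> \<open>decreases to the indicator of \<open>B\<close>, since \<open>infdist z B > 0\<close> off the closed set \<open>B\<close>\<close>
    define h where "h n z = (1 / (1 + infdist z B)) ^ n" for n :: nat and z
    have cont: "continuous_on UNIV (h n)" for n
      unfolding h_def by (intro continuous_intros) (smt (verit) infdist_nonneg)
    have h_le: "\<bar>h n z\<bar> \<le> 1" for n z
      using infdist_nonneg[of z B] by (auto simp: h_def power_abs intro!: power_le_one)
    have "(\<lambda>n. \<integral>z. complex_of_real (h n z) * \<phi> z \<partial>?M) \<longlonglongrightarrow> (\<integral>z. indicator B z *\<^sub>R \<phi> z \<partial>?M)"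
    proof (rule integral_dominated_convergence[where w = "\<lambda>z. norm (\<phi> z)"])
      show "AE z in ?M. (\<lambda>n. complex_of_real (h n z) * \<phi> z) \<longlonglongrightarrow> indicator B z *\<^sub>R \<phi> z"
      proof (rule AE_I2)
        fix z
        have "(\<lambda>n. h n z) \<longlonglongrightarrow> indicator B z"
        proof (cases "z \<in> B")
          case True
          then show ?thesis by (simp add: h_def)
        next
          case False
          then have "infdist z B > 0"
            using B \<open>B \<noteq> {}\<close> by (metis in_closed_iff_infdist_zero infdist_nonneg less_eq_real_def)
          then show ?thesis
            using False unfolding h_def by (auto intro!: LIMSEQ_power_zero)
        qed
        then show "(\<lambda>n. complex_of_real (h n z) * \<phi> z) \<longlonglongrightarrow> indicator B z *\<^sub>R \<phi> z"
          unfolding scaleR_conv_of_real by (intro tendsto_intros)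
      qed
      show "AE z in ?M. norm (complex_of_real (h n z) * \<phi> z) \<le> norm (\<phi> z)" for n
        using h_le by (intro AE_I2) (simp add: norm_mult mult_left_le_one_le)
      show "(\<lambda>z. complex_of_real (h n z) * \<phi> z) \<in> borel_measurable ?M" for n
        using int measurable_compose[OF id borel_measurable_continuous_onI[OF cont]] by measurable
      show "(\<lambda>z. indicator B z *\<^sub>R \<phi> z) \<in> borel_measurable ?M"
        using B by (intro borel_measurable_scaleR meas borel_measurable_integrable[OF int]) simp
    qed (use int in auto)
    moreover have "(\<integral>z. complex_of_real (h n z) * \<phi> z \<partial>?M) = 0" for n
      by (rule fourier_null_continuous[OF \<phi> cont])
    ultimately show ?thesis
      using LIMSEQ_unique[OF tendsto_const] by fastforce
  qed simp
  have zero: "(\<integral>z. indicator B z *\<^sub>R \<phi> z \<partial>?M) = 0" if "B \<in> sets borel" for B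
  proof -
    have "Int_stable (Collect closed :: (complex \<times> complex) set set)"
      by (auto simp: Int_stable_def)
    moreover have "Collect closed \<subseteq> Pow (UNIV :: (complex \<times> complex) set)"
      by simp
    moreover have "B \<in> sigma_sets UNIV (Collect closed)"
      using that unfolding borel_eq_closed by simp
    ultimately show ?thesis
    proof (induction rule: sigma_sets_induct_disjoint)
      case (compl A)
      then have "A \<in> sets borel"
        by (simp add: borel_eq_closed)
      have "(\<integral>z. indicator (UNIV - A) z *\<^sub>R \<phi> z \<partial>?M) = (\<integral>z. \<phi> z - indicator A z *\<^sub>R \<phi> z \<partial>?M)"
        by (intro Bochner_Integration.integral_cong) (auto simp: indicator_def)
      then show ?case
        using compl int_B[OF \<open>A \<in> sets borel\<close>] int UNIV by simp
    next
      case (union A)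
      have A: "A n \<in> sets borel" for n
        using union(2) by (auto simp: borel_eq_closed)
      have A_space: "A n \<inter> space ?M \<in> sets ?M" for n
        using measurable_sets[OF id A[of n]] by (simp add: vimage_def)
      have restrict: "(\<integral>z. indicator B z *\<^sub>R \<phi> z \<partial>?M) = set_lebesgue_integral ?M (B \<inter> space ?M) \<phi>" for B
        unfolding set_lebesgue_integral_def
        by (intro Bochner_Integration.integral_cong) (auto simp: indicator_def)
      have "set_integrable ?M (\<Union>n. A n \<inter> space ?M) \<phi>"
        unfolding set_integrable_def using A_space int by (intro integrable_mult_indicator sets.countable_UN) auto
      then have "set_lebesgue_integral ?M (\<Union>n. A n \<inter> space ?M) \<phi>
          = (\<Sum>n. set_lebesgue_integral ?M (A n \<inter> space ?M) \<phi>)"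
        using union(1) by (intro lebesgue_integral_countable_add A_space) (auto simp: disjoint_family_on_def)
      also have "\<dots> = 0"
        using union(3) by (simp flip: restrict)
      finally show ?case
        by (simp add: restrict)
    qed (use zero_closed in auto)
  qed
  show ?thesis
  proof (rule density_zero[OF int])
    fix A assume "A \<in> sets ?M"
    then obtain B where B: "B \<in> sets borel" "A = B \<inter> space ?M"
      by (rule sets_torus_measure_borel)
    have "set_lebesgue_integral ?M A \<phi> = (\<integral>z. indicator B z *\<^sub>R \<phi> z \<partial>?M)"
      unfolding set_lebesgue_integral_def B(2)
      by (intro Bochner_Integration.integral_cong) (auto simp: indicator_def)
    then show "set_lebesgue_integral ?M A \<phi> = 0"
      using zero[OF B(1)] by simp
  qed
qed

section \<open>Multiplication operators on the torus\<close>

lemma cinner_abs_torus_L2: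
  assumes "square_integrable_torus f" "square_integrable_torus g"
  shows "cinner (abs_torus_L2 f) (abs_torus_L2 g) = (\<integral>z. cinner (f z) (g z) \<partial>torus_measure)"
  using assms by (intro cinner_torus_L2.abs_eq) (simp_all add: torus_L2_rel_def)

lemma abs_torus_L2_eqI:
  assumes "square_integrable_torus f" "square_integrable_torus g" "AE z in torus_measure. f z = g z"
  shows "abs_torus_L2 f = abs_torus_L2 g"
  using assms by (intro Quotient3_rel_abs[OF Quotient3_torus_L2]) (simp add: torus_L2_rel_def)

lemma measurable_cnj_torus [measurable]:
  "(\<lambda>z. cnj (fst z)) \<in> borel_measurable torus_measure"
  "(\<lambda>z. cnj (snd z)) \<in> borel_measurable torus_measure"
proof -
  have "cnj \<in> borel_measurable borel"
    by (intro borel_measurable_continuous_onI continuous_intros)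
  then show "(\<lambda>z. cnj (fst z)) \<in> borel_measurable torus_measure"
    and "(\<lambda>z. cnj (snd z)) \<in> borel_measurable torus_measure"
    by (rule measurable_compose[rotated], measurable)+
qed

lift_definition torus_V1 ::
    "('b :: {chilbert_space, second_countable_topology}) torus_L2 \<Rightarrow> 'b torus_L2"
  is "\<lambda>f z. cnj (fst z) *\<^sub>C f z"
  by (auto simp: torus_L2_rel_def space_torus_measure measurable_cnj_torus elim: eventually_mono
      intro!: square_integrable_torus_multiplier[where K = 1])

lift_definition torus_V2 ::
    "('b :: {chilbert_space, second_countable_topology}) torus_L2 \<Rightarrow> 'b torus_L2"
  is "\<lambda>f z. cnj (snd z) *\<^sub>C f z"
  by (auto simp: torus_L2_rel_def space_torus_measure measurable_cnj_torus elim: eventually_mono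
      intro!: square_integrable_torus_multiplier[where K = 1])

lemma torus_shift_adjoint:
  "cinner (torus_U1 F) G = cinner F (torus_V1 G)" "cinner (torus_U2 F) G = cinner F (torus_V2 G)"
  by (transfer, simp add: cinner_scaleC_left cinner_scaleC_right)+

lemma torus_shift_inverse:
  "torus_U1 (torus_V1 F) = F" "torus_V1 (torus_U1 F) = F"
  "torus_U2 (torus_V2 F) = F" "torus_V2 (torus_U2 F) = F"
proof -
  have cancel: "torus_L2_rel (\<lambda>z. c z *\<^sub>C d z *\<^sub>C f z) f"
    if f: "torus_L2_rel f f" and c: "c \<in> borel_measurable torus_measure" and d: "d \<in> borel_measurable torus_measure"
      and cd: "\<And>z. z \<in> space torus_measure \<Longrightarrow> cmod (c z) = 1 \<and> d z = cnj (c z)"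
    for c d and f :: "complex \<times> complex \<Rightarrow> 'a"
  proof -
    have "square_integrable_torus f"
      using f by (simp add: torus_L2_rel_def)
    then have "square_integrable_torus (\<lambda>z. d z *\<^sub>C f z)"
      by (rule square_integrable_torus_multiplier[OF _ d, where K = 1]) (simp add: cd)
    then have "square_integrable_torus (\<lambda>z. c z *\<^sub>C d z *\<^sub>C f z)"
      by (rule square_integrable_torus_multiplier[OF _ c, where K = 1]) (simp add: cd)
    moreover have "c z *\<^sub>C d z *\<^sub>C f z = f z" if "z \<in> space torus_measure" for z
    proof -
      have "c z * d z = 1"
        using cd[OF that] complex_norm_square[of "c z"] by simp
      then show ?thesis
        by (simp add: scaleC_scaleC)
    qed
    ultimately show ?thesis
      using f by (simp add: torus_L2_rel_def AE_I2)
  qed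
  show "torus_U1 (torus_V1 F) = F" "torus_V1 (torus_U1 F) = F"
    "torus_U2 (torus_V2 F) = F" "torus_V2 (torus_U2 F) = F"
    by (transfer, rule cancel, assumption,
        auto simp: space_torus_measure measurable_cnj_torus measurable_fst_torus measurable_snd_torus)+
qed

lemma cinner_ell2_unit: "cinner x (ell2_unit i) = ell2_coeff x i"
proof -
  have "cinner x (ell2_unit i) = (\<Sum>\<^sub>\<infinity>j\<in>{i}. ell2_coeff x j * cnj (if j = i then 1 else 0))"
    unfolding cinner_ell2.rep_eq ell2_coeff_unit by (rule infsum_cong_neutral) auto
  then show ?thesis by simp
qed

definition torus_basis :: "int \<times> int \<times> ('i :: countable) \<Rightarrow> 'i ell2 torus_L2" where
  "torus_basis = (\<lambda>(k, j, i). abs_torus_L2 (\<lambda>z. torus_char k j z *\<^sub>C ell2_unit i))"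

lemma square_integrable_torus_char:
  "square_integrable_torus (\<lambda>z. torus_char k j z *\<^sub>C x)"
  by (rule square_integrable_torus_multiplier[where K = 1])
    (auto simp: square_integrable_torus_const norm_torus_char)

lemma torus_basis_shift:
  "torus_U1 (torus_basis (k, j, i)) = torus_basis (k + 1, j, i)"
  "torus_U2 (torus_basis (k, j, i)) = torus_basis (k, j + 1, i)"
proof -
  let ?f = "\<lambda>z. torus_char k j z *\<^sub>C ell2_unit i"
  have U1: "torus_U1 (torus_basis (k, j, i)) = abs_torus_L2 (\<lambda>z. fst z *\<^sub>C ?f z)"
    unfolding torus_basis_def prod.case
    by (rule torus_U1.abs_eq) (simp add: torus_L2_rel_def square_integrable_torus_char)
  have U2: "torus_U2 (torus_basis (k, j, i)) = abs_torus_L2 (\<lambda>z. snd z *\<^sub>C ?f z)"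
    unfolding torus_basis_def prod.case
    by (rule torus_U2.abs_eq) (simp add: torus_L2_rel_def square_integrable_torus_char)
  have sq: "square_integrable_torus (\<lambda>z. fst z *\<^sub>C ?f z)" "square_integrable_torus (\<lambda>z. snd z *\<^sub>C ?f z)"
    by (rule square_integrable_torus_multiplier[OF square_integrable_torus_char, where K = 1];
        auto simp: space_torus_measure)+
  show "torus_U1 (torus_basis (k, j, i)) = torus_basis (k + 1, j, i)"
    unfolding U1 unfolding torus_basis_def prod.case
  proof (rule abs_torus_L2_eqI)
    show "AE z in torus_measure. fst z *\<^sub>C ?f z = torus_char (k + 1) j z *\<^sub>C ell2_unit i"
      by (intro AE_I2) (simp add: fst_torus_eq torus_char_mult scaleC_scaleC add.commute)
  qed (intro sq square_integrable_torus_char)+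
  show "torus_U2 (torus_basis (k, j, i)) = torus_basis (k, j + 1, i)"
    unfolding U2 unfolding torus_basis_def prod.case
  proof (rule abs_torus_L2_eqI)
    show "AE z in torus_measure. snd z *\<^sub>C ?f z = torus_char k (j + 1) z *\<^sub>C ell2_unit i"
      by (intro AE_I2) (simp add: snd_torus_eq torus_char_mult scaleC_scaleC add.commute)
  qed (intro sq square_integrable_torus_char)+
qed

lemma cinner_torus_basis:
  fixes f :: "complex \<times> complex \<Rightarrow> 'i :: countable ell2"
  assumes "square_integrable_torus f"
  shows "cinner (abs_torus_L2 f) (torus_basis (k, j, i))
    = (\<integral>z. torus_char (- k) (- j) z * ell2_coeff (f z) i \<partial>torus_measure)"
  unfolding torus_basis_def prod.case cinner_abs_torus_L2[OF assms square_integrable_torus_char]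
  by (intro Bochner_Integration.integral_cong) (simp_all add: cinner_scaleC_right cinner_ell2_unit cnj_torus_char)

lemma torus_basis_orthonormal:
  "cinner (torus_basis \<kappa>) (torus_basis \<kappa>') = (if \<kappa> = \<kappa>' then 1 else 0)"
proof (cases \<kappa>, cases \<kappa>')
  fix k j k' j' :: int and i i' :: 'a
  assume \<kappa>: "\<kappa> = (k, j, i)" "\<kappa>' = (k', j', i')"
  have "cinner (torus_basis \<kappa>) (torus_basis \<kappa>')
      = (\<integral>z. torus_char (- k') (- j') z * ell2_coeff (torus_char k j z *\<^sub>C ell2_unit i) i' \<partial>torus_measure)"
    unfolding \<kappa> by (subst torus_basis_def) (simp add: cinner_torus_basis square_integrable_torus_char)
  also have "\<dots> = (\<integral>z. torus_char (- k' + k) (- j' + j) z * (if i = i' then 1 else 0) \<partial>torus_measure)"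
    by (intro Bochner_Integration.integral_cong refl)
      (auto simp: scaleC_ell2.rep_eq ell2_coeff_unit torus_char_mult)
  also have "\<dots> = (if \<kappa> = \<kappa>' then 1 else 0)"
    by (auto simp: \<kappa> integral_torus_char)
  finally show ?thesis .
qed

text \<open>
  The coordinates of \<open>f\<close> with a fixed last index \<open>i\<close> are the Fourier coefficients of its \<open>i\<close>-th
  component.
\<close>

lemma torus_coefficient_AE_zero:
  fixes f :: "complex \<times> complex \<Rightarrow> 'i :: countable ell2"
  assumes f: "square_integrable_torus f"
    and zero: "\<And>k j. cinner (abs_torus_L2 f) (torus_basis (k, j, i)) = 0"
  shows "AE z in torus_measure. ell2_coeff (f z) i = 0"
proof (rule fourier_null_AE_zero)
  have "integrable torus_measure (\<lambda>z. cinner (f z) (ell2_unit i))"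
    by (rule integrable_cinner_torus[OF f square_integrable_torus_const])
  moreover have "(\<integral>z. torus_char k j z * ell2_coeff (f z) i \<partial>torus_measure) = 0" for k j
    using zero[of "- k" "- j"] by (simp add: cinner_torus_basis[OF f])
  ultimately show "fourier_null (\<lambda>z. ell2_coeff (f z) i)"
    by (simp add: fourier_null_def cinner_ell2_unit)
qed

lemma torus_basis_total:
  fixes F :: "'i :: countable ell2 torus_L2"
  assumes "\<And>\<kappa>. cinner F (torus_basis \<kappa>) = 0"
  shows "F = 0"
proof -
  obtain f where f: "square_integrable_torus f" "F = abs_torus_L2 f"
    by (rule torus_L2_cases)
  have "AE z in torus_measure. \<forall>i. ell2_coeff (f z) i = 0"
    unfolding AE_all_countable using assms torus_coefficient_AE_zero[OF f(1)] f(2) by blast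
  then have "AE z in torus_measure. f z = 0"
    by eventually_elim (simp add: ell2_coeff_inject[symmetric] fun_eq_iff zero_ell2.rep_eq)
  then have "F = abs_torus_L2 (\<lambda>_. 0)"
    unfolding f(2) by (intro abs_torus_L2_eqI f square_integrable_torus_const)
  then show ?thesis
    by (simp add: zero_torus_L2_def)
qed

interpretation torus: bilateral_shifts torus_basis torus_U1 torus_U2 torus_V1 torus_V2
  by unfold_locales
    (rule torus_basis_orthonormal torus_basis_total torus_shift_adjoint torus_shift_inverse
      torus_basis_shift; assumption?)+

text \<open>
  A function with vanishing coordinates off \<open>I\<close> takes values in \<^term>\<open>ell2_on I\<close> only almost everywhere;
  it is set to zero on the exceptional null set (and off the torus) to obtain a representative that does
  so everywhere. The exceptional sets of the countably many components are united.
\<close>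

lemma torus_L2_ell2_eq_spanned: "torus_L2_ell2 I = torus.spanned I"
proof
  show "torus_L2_ell2 I \<subseteq> torus.spanned I"
  proof
    fix F assume "F \<in> torus_L2_ell2 I"
    then obtain f where f: "square_integrable_torus f" "\<And>z. f z \<in> ell2_on I" "F = abs_torus_L2 f"
      by (auto simp: torus_L2_ell2_def)
    have "ell2_coeff (f z) i = 0" if "i \<notin> I" for i z
      using f(2)[of z] that by (simp add: ell2_on_def)
    then show "F \<in> torus.spanned I"
      by (simp add: torus.spanned_def f(3) cinner_torus_basis[OF f(1)])
  qed
  show "torus.spanned I \<subseteq> torus_L2_ell2 I"
  proof
    fix F assume F: "F \<in> torus.spanned I"
    obtain f where f: "square_integrable_torus f" "F = abs_torus_L2 f"
      by (rule torus_L2_cases)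
    have "AE z in torus_measure. \<forall>i. i \<notin> I \<longrightarrow> ell2_coeff (f z) i = 0"
      unfolding AE_all_countable
    proof
      fix i
      show "AE z in torus_measure. i \<notin> I \<longrightarrow> ell2_coeff (f z) i = 0"
        using F torus_coefficient_AE_zero[OF f(1), of i] by (cases "i \<in> I") (auto simp: f(2) torus.spanned_def)
    qed
    then obtain N where N: "N \<in> null_sets torus_measure"
      "{z \<in> space torus_measure. \<not> (\<forall>i. i \<notin> I \<longrightarrow> ell2_coeff (f z) i = 0)} \<subseteq> N"
      by (rule AE_E) (auto simp: null_sets_def)
    define g where "g z = (if z \<in> N \<or> z \<notin> space torus_measure then 0 else f z)" for z
    have "AE z in torus_measure. z \<notin> N"
      by (rule AE_not_in[OF N(1)])
    then have eq: "AE z in torus_measure. g z = f z"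
      using AE_space by eventually_elim (simp add: g_def)
    have "(\<lambda>z. if z \<in> N then 0 else f z) \<in> borel_measurable torus_measure"
      using N(1) f(1) by (intro measurable_If_set) (auto simp: square_integrable_torus_def)
    moreover have "g z = (if z \<in> N then 0 else f z)" if "z \<in> space torus_measure" for z
      using that by (simp add: g_def)
    ultimately have meas: "g \<in> borel_measurable torus_measure"
      by (simp cong: measurable_cong)
    have "integrable torus_measure (\<lambda>z. (norm (g z))\<^sup>2)
        \<longleftrightarrow> integrable torus_measure (\<lambda>z. (norm (f z))\<^sup>2)"
      using eq meas f(1) by (intro integrable_cong_AE) (auto simp: square_integrable_torus_def elim: eventually_mono)
    then have g: "square_integrable_torus g"
      using meas f(1) by (simp add: square_integrable_torus_def)
    have "F = abs_torus_L2 g"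
      unfolding f(2) using eq by (intro abs_torus_L2_eqI f g) (auto elim: eventually_mono)
    moreover have "g z \<in> ell2_on I" for z
      using N(2) by (auto simp: g_def ell2_on_def zero_ell2.rep_eq)
    ultimately show "F \<in> torus_L2_ell2 I"
      using g by (auto simp: torus_L2_ell2_def)
  qed
qed

section \<open>Bilateral frame-tuples\<close>

lemma torus_const_unit: "torus_const (ell2_unit i) = torus_basis (0, 0, i)"
proof -
  have "torus_const (ell2_unit i) = abs_torus_L2 (\<lambda>_. ell2_unit i)"
    by (simp add: torus_const_def)
  then show ?thesis
    by (simp add: torus_basis_def)
qed

definition basic_tuple :: "'i set \<Rightarrow> 'i ell2 torus_L2 set \<Rightarrow> ('i :: countable ell2 torus_L2, 'i) operator_tuple" where
  "basic_tuple I N = (N, restrict torus_U1 N, restrict torus_U2 N,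
     restrict (\<lambda>i. orthogonal_projection N (torus_const (ell2_unit i))) I)"

lemma similar_basic_tuple_iff:
  "bilateral_basic_tuple I B \<and> similar_tuples I (UNIV, T, L, w) B
    \<longleftrightarrow> (\<exists>N C. B = basic_tuple I N \<and> torus.basic_model I T L w N C)"
proof
  assume B: "bilateral_basic_tuple I B \<and> similar_tuples I (UNIV, T, L, w) B"
  then obtain N where N: "closed_csubspace N" "N \<subseteq> torus_L2_ell2 I" "reducing torus_U1 N" "reducing torus_U2 N"
    "B = basic_tuple I N"
    unfolding bilateral_basic_tuple_def basic_tuple_def by blast
  obtain C where C: "bounded_clinear_on UNIV N C" "bij_betw C UNIV N"
    "\<And>i. i \<in> I \<Longrightarrow> C (w i) = orthogonal_projection N (torus_const (ell2_unit i))"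
    "\<And>x. restrict torus_U1 N (C x) = C (T x)" "\<And>x. restrict torus_U2 N (C x) = C (L x)"
    using B unfolding N(5) basic_tuple_def by auto
  have "C x \<in> N" for x
    using C(2) by (auto simp: bij_betw_def)
  then have "torus.basic_model I T L w N C"
    using N(1-4) C unfolding torus.basic_model_def reducing_def torus.cadjoint_shift
      torus_L2_ell2_eq_spanned torus_const_unit by auto
  then show "\<exists>N C. B = basic_tuple I N \<and> torus.basic_model I T L w N C"
    using N(5) by blast
next
  assume "\<exists>N C. B = basic_tuple I N \<and> torus.basic_model I T L w N C"
  then obtain N C where B: "B = basic_tuple I N" and model: "torus.basic_model I T L w N C"
    by blast
  have mem: "C x \<in> N" for x
    using model by (auto simp: torus.basic_model_def bij_betw_def)
  have "bilateral_basic_tuple I B"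
    using model unfolding B bilateral_basic_tuple_def basic_tuple_def torus.basic_model_def reducing_def
      torus.cadjoint_shift torus_L2_ell2_eq_spanned by blast
  moreover have "similar_tuples I (UNIV, T, L, w) B"
    using model mem unfolding B basic_tuple_def torus.basic_model_def torus_const_unit similar_tuples.simps
    by (intro exI[of _ C]) auto
  ultimately show "bilateral_basic_tuple I B \<and> similar_tuples I (UNIV, T, L, w) B"
    by blast
qed

theorem theorem3p13:
  fixes T L :: "'h :: {chilbert_space, second_countable_topology} \<Rightarrow> 'h"
    and w :: "'i :: countable \<Rightarrow> 'h"
    and I :: "'i set"
  assumes "bilateral_tuple I (UNIV, T, L, w)"
  shows "(bilateral_frame_tuple I (UNIV, T, L, w) \<longleftrightarrow>
            (\<exists>B. bilateral_basic_tuple I B \<and> similar_tuples I (UNIV, T, L, w) B)) \<and>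
         (\<forall>B B'. bilateral_basic_tuple I B \<and> similar_tuples I (UNIV, T, L, w) B \<and>
            bilateral_basic_tuple I B' \<and> similar_tuples I (UNIV, T, L, w) B' \<longrightarrow> B = B')"
proof (intro conjI allI impI)
  have inv: "invertible_operator_on UNIV T" "invertible_operator_on UNIV L"
    and comm: "\<And>x. T (L x) = L (T x)"
    using assms by auto
  note bij = inv[THEN invertible_operator_on_UNIV_bij]
  have "bilateral_frame_tuple I (UNIV, T, L, w) \<longleftrightarrow> is_frame_of UNIV (UNIV \<times> UNIV \<times> I) (orbit T L w)"
    using assms by (simp add: orbit_def)
  also have "\<dots> \<longleftrightarrow> (\<exists>N C. torus.basic_model I T L w N C)"
    using torus.frame_basic_model[where T = T and L = L, OF inv comm]
      torus.basic_model_frame[where T = T and L = L, OF _ bij comm] by metis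
  also have "\<dots> \<longleftrightarrow> (\<exists>B. bilateral_basic_tuple I B \<and> similar_tuples I (UNIV, T, L, w) B)"
    unfolding similar_basic_tuple_iff by blast
  finally show "bilateral_frame_tuple I (UNIV, T, L, w) \<longleftrightarrow>
      (\<exists>B. bilateral_basic_tuple I B \<and> similar_tuples I (UNIV, T, L, w) B)" .
  fix B B'
  assume "bilateral_basic_tuple I B \<and> similar_tuples I (UNIV, T, L, w) B \<and>
    bilateral_basic_tuple I B' \<and> similar_tuples I (UNIV, T, L, w) B'"
  then obtain N C N' C' where "B = basic_tuple I N" "torus.basic_model I T L w N C"
    "B' = basic_tuple I N'" "torus.basic_model I T L w N' C'"
    using similar_basic_tuple_iff by metis
  then show "B = B'"
    using torus.basic_model_unique[where T = T and L = L, OF _ _ bij comm] by metis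
qed

end
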